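(* Let $a_1, a_2, \ldots \in (0,1)$ be independent random variables with common c.d.f. $G(x) = \mathbb P(a_i \le x)$ such that, for some $\epsilon \in (0,1)$, $G$ is continuously differentiable on $(1-\epsilon,1)$ with derivative satisfying $$ g(x) = \kappa \beta (1-x)^{\beta-1}\big(1 + O((1-x)^\nu)\big), \qquad x \to 1-, $$ for some $\beta > 1$, $\nu > 0$, $\kappa > 0$. For each $N$, let $\widehat a_i = a_i + \widehat \rho_i$, $i=1,\ldots,N$, where $\widehat\rho_i = \widehat\rho_{i,N}$ are arbitrary random variables (no independence or dependence structure assumed). Fix $r > 1$, let $\delta = \delta_N > 0$, put $\widetilde a_i := \min\{\widehat a_i, 1-\delta^r\}$ and $$ \widetilde \beta_N := \frac{\sum_{i=1}^N \mathbf 1(\widetilde a_i > 1-\delta)}{\sum_{i=1}^N \mathbf 1(\widetilde a_i > 1-\delta)\ln\big(\delta/(1-\widetilde a_i)\big)}. $$ Assume that, as $N \to \infty$, $\delta = \delta_N \to 0$ so that $$ N\delta^\beta \to \infty \quad\text{and}\quad N \delta^{\beta + 2\min\{\nu,(r-1)\beta\}} \to 0. $$ In addition, assume that for some $p \ge 1$, $$ \max_{1 \le i \le N} \mathbb P(|\widehat\rho_i| > \varepsilon) \le \frac{\chi}{\varepsilon^p} + \chi' \qquad \text{for all } \varepsilon \in (0,1), $$ where $\chi = \chi_N \to 0$ and $\chi' = \chi'_N \to 0$ satisfy $$ \sqrt{N\delta^\beta}\,\max\Big\{\frac{\chi'}{\delta^\beta}, \Big(\frac{\chi}{\delta^{p+\beta}}\Big)^{1/(p+1)}\Big\}\ln\delta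 \to 0. $$ Then $$ \sqrt{N\delta^\beta}\,(\widetilde\beta_N - \beta) \to_d \mathcal N(0, \beta^2/\kappa). $$
   Context: $\to_d$ denotes convergence in distribution and $\mathcal N(\mu,\sigma^2)$ the normal distribution with mean $\mu$ and variance $\sigma^2$. All limits are as $N \to \infty$. *)

theory Defs
  imports "HOL-Probability.Probability" "HOL-Library.Landau_Symbols"
begin

definition tilde_a :: "real \<Rightarrow> real \<Rightarrow> real \<Rightarrow> real" where
  "tilde_a d r ahat = min ahat (1 - d powr r)"

definition beta_est :: "nat \<Rightarrow> real \<Rightarrow> real \<Rightarrow> (nat \<Rightarrow> real) \<Rightarrow> real" where
  "beta_est N d r ahat =
     (\<Sum>i=1..N. if tilde_a d r (ahat i) > 1 - d then 1 else 0) /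
     (\<Sum>i=1..N. if tilde_a d r (ahat i) > 1 - d
                  then ln (d / (1 - tilde_a d r (ahat i))) else 0)"

end

theory Submission
  imports Defs "HOL-Real_Asymp.Real_Asymp"
begin

text \<open>Let \<open>\<phi>\<close> be the truncated log excess \<open>ln (\<delta> / (1 - x))\<close> over the threshold \<open>1 - \<delta>\<close>, let \<open>\<psi>\<close> be the
  indicator of \<open>\<phi> > 0\<close>, and let \<open>s = sqrt (N \<delta>\<^sup>\<beta>)\<close>. The normalised estimation error is the quotient of
  \<open>\<Sum> (\<psi> - \<beta> \<phi>) / s\<close> and \<open>\<Sum> \<phi> / s\<^sup>2\<close>. Since \<open>P (\<phi> > t)\<close> is \<open>\<kappa> \<delta>\<^sup>\<beta> exp (- \<beta> t)\<close> up to a relative error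
  \<open>O (\<delta>\<^sup>\<nu>)\<close>, below the truncation level \<open>(r - 1) ln (1 / \<delta>)\<close>, the layer cake formula yields all moments: without
  perturbations the numerator has vanishing mean (this uses the bias condition on \<open>N\<close> and \<open>\<delta>\<close>) and
  variance tending to \<open>\<kappa>\<close>, and a Taylor expansion of characteristic functions gives its normal
  limit, while the denominator tends to \<open>\<kappa> / \<beta>\<close> in mean square. As \<open>\<phi>\<close> is monotone, a perturbation of
  size at most \<open>e\<close> changes it by at most \<open>\<phi> (a + e) - \<phi> (a - e)\<close>, whose mean is again computed from the
  tail of \<open>\<phi>\<close>; so the perturbations change numerator and denominator by a quantity tending to 0
  in \<open>L\<^sup>1\<close>, whatever their dependence structure.\<close>

section \<open>Moments from tails and second moments of sums\<close>

text \<open>The score \<psi> - \<beta> \<phi> is natural because an exponential variable of rate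
  \<beta> has mean 1/\<beta>: the leading terms of its mean cancel. What remains is the tail error,
  of relative order \<delta>^\<nu>, and the part of the exponential cut off by the truncation, of
  relative order \<delta>^((r-1)\<beta>). Multiplied by N and divided by s, this bias is of order
  sqrt(N \<delta>^(\<beta> + 2 min)), which is where the second condition on \<delta> comes from.
  The second moment has leading coefficient \<kappa> (1 - 2 + 2) = \<kappa>, and division by the
  limit \<kappa>/\<beta> of the denominator turns it into \<beta>^2/\<kappa>. The obstacle is the
  steepness of \<phi>: its slope grows up to \<delta>^(-r) before the truncation, so a Lipschitz
  estimate of the perturbation would lose powers of \<delta>. Comparing level sets of \<phi> loses
  only the length of its range, a multiple of ln(1/\<delta>); this accounts for the logarithm in the
  hypothesis on \<open>chi\<close> and \<open>chi'\<close>. The effect is bounded in mean index by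
  index, so only the marginal tails of the perturbations enter.\<close>

lemma (in prob_space) nn_integral_layer_cake:
  fixes Y :: "'a \<Rightarrow> real" and f F :: "real \<Rightarrow> real"
  assumes Y[measurable]: "Y \<in> borel_measurable M"
    and Y_range: "\<And>x. x \<in> space M \<Longrightarrow> 0 \<le> Y x \<and> Y x \<le> L"
    and F: "\<And>t. 0 \<le> t \<Longrightarrow> t \<le> L \<Longrightarrow> DERIV F t :> f t" and F0: "F 0 = 0"
    and f_nonneg: "\<And>t. 0 \<le> t \<Longrightarrow> t \<le> L \<Longrightarrow> 0 \<le> f t"
    and f[measurable]: "f \<in> borel_measurable borel"
  shows "(\<integral>\<^sup>+x. ennreal (F (Y x)) \<partial>M) =
    (\<integral>\<^sup>+t. ennreal (f t) * indicator {0..<L} t * emeasure M {x\<in>space M. Y x > t} \<partial>lborel)"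
proof -
  \<comment> \<open>\<open>F (Y x)\<close> is the integral of \<open>f\<close> over
    [0, \<open>Y x\<close>], and Tonelli exchanges the integrals. The range stops short of
    \<open>L\<close> because the tail of the truncated excess will be known only strictly below the
    truncation level, where its law may have an atom.\<close>
  have "(\<integral>\<^sup>+x. ennreal (F (Y x)) \<partial>M) =
    (\<integral>\<^sup>+x. (\<integral>\<^sup>+t. ennreal (f t) * indicator {0..<L} t * indicator {t. t < Y x} t \<partial>lborel) \<partial>M)"
  proof (rule nn_integral_cong)
    fix x assume x: "x \<in> space M"
    have "ennreal (F (Y x)) = ennreal (F (Y x) - F 0)" by (simp add: F0)
    also have "\<dots> = (\<integral>\<^sup>+t. ennreal (f t) * indicator {0..Y x} t \<partial>lborel)"
      using Y_range[OF x] F f_nonneg by (intro nn_integral_FTC_Icc[symmetric]) auto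
    also have "\<dots> = (\<integral>\<^sup>+t. ennreal (f t) * indicator {0..<L} t * indicator {t. t < Y x} t \<partial>lborel)"
    proof (rule nn_integral_cong_AE)
      show "AE t in lborel. ennreal (f t) * indicator {0..Y x} t =
          ennreal (f t) * indicator {0..<L} t * indicator {t. t < Y x} t"
        using AE_lborel_singleton[of "Y x"]
        by eventually_elim (use Y_range[OF x] in \<open>auto split: split_indicator\<close>)
    qed
    finally show "ennreal (F (Y x)) =
      (\<integral>\<^sup>+t. ennreal (f t) * indicator {0..<L} t * indicator {t. t < Y x} t \<partial>lborel)" .
  qed
  also have "\<dots> = (\<integral>\<^sup>+t. (\<integral>\<^sup>+x. ennreal (f t) * indicator {0..<L} t * indicator {t. t < Y x} t \<partial>M) \<partial>lborel)"
  proof -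
    interpret pair_sigma_finite lborel M by standard
    show ?thesis
      by (rule Fubini') measurable
  qed
  also have "\<dots> = (\<integral>\<^sup>+t. ennreal (f t) * indicator {0..<L} t * emeasure M {x\<in>space M. Y x > t} \<partial>lborel)"
  proof (rule nn_integral_cong)
    fix t
    have "(\<integral>\<^sup>+x. ennreal (f t) * indicator {0..<L} t * indicator {t. t < Y x} t \<partial>M) =
      (\<integral>\<^sup>+x. ennreal (f t) * indicator {0..<L} t * indicator {x\<in>space M. Y x > t} x \<partial>M)"
      by (intro nn_integral_cong) (auto split: split_indicator)
    also have "\<dots> = ennreal (f t) * indicator {0..<L} t * emeasure M {x\<in>space M. Y x > t}"
      by (subst nn_integral_cmult_indicator) auto
    finally show "(\<integral>\<^sup>+x. ennreal (f t) * indicator {0..<L} t * indicator {t. t < Y x} t \<partial>M) = \<dots>" .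
  qed
  finally show ?thesis .
qed

text \<open>The layer cake formula turns bounds on the tail into bounds on the moment, and
  \<open>H\<close>, a primitive of \<open>f t * exp (- b * t)\<close>, evaluates the resulting
  integral in closed form.\<close>

lemma (in prob_space) expectation_exp_tail_bounds:
  fixes Y :: "'a \<Rightarrow> real" and f F H :: "real \<Rightarrow> real"
  assumes Y[measurable]: "Y \<in> borel_measurable M"
    and Y_range: "\<And>x. x \<in> space M \<Longrightarrow> 0 \<le> Y x \<and> Y x \<le> L" and L: "0 \<le> L"
    and F: "\<And>t. 0 \<le> t \<Longrightarrow> t \<le> L \<Longrightarrow> DERIV F t :> f t" and F0: "F 0 = 0"
    and f_nonneg: "\<And>t. 0 \<le> t \<Longrightarrow> t \<le> L \<Longrightarrow> 0 \<le> f t"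
    and f[measurable]: "f \<in> borel_measurable borel"
    and H: "\<And>t. 0 \<le> t \<Longrightarrow> t \<le> L \<Longrightarrow> DERIV H t :> f t * exp (- b * t)"
    and tail: "\<And>t. 0 \<le> t \<Longrightarrow> t < L \<Longrightarrow> lo * exp (- b * t) \<le> prob {x\<in>space M. Y x > t}
        \<and> prob {x\<in>space M. Y x > t} \<le> hi * exp (- b * t)"
    and lo: "0 \<le> lo" "0 \<le> hi"
    and int: "integrable M (\<lambda>x. F (Y x))"
  shows "lo * (H L - H 0) \<le> expectation (\<lambda>x. F (Y x))"
    and "expectation (\<lambda>x. F (Y x)) \<le> hi * (H L - H 0)"
proof -
  have F_nonneg: "0 \<le> F (Y x)" if "x \<in> space M" for x
  proof -
    have "F 0 \<le> F (Y x)"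
    proof (rule DERIV_nonneg_imp_nondecreasing[where f=F])
      fix t assume "0 \<le> t" "t \<le> Y x"
      then show "\<exists>y. DERIV F t :> y \<and> 0 \<le> y"
        using F[of t] f_nonneg[of t] Y_range[OF that] by (intro exI[of _ "f t"]) auto
    qed (use Y_range[OF that] in auto)
    then show ?thesis by (simp add: F0)
  qed
  have eq: "ennreal (expectation (\<lambda>x. F (Y x))) =
    (\<integral>\<^sup>+t. ennreal (f t) * indicator {0..<L} t * emeasure M {x\<in>space M. Y x > t} \<partial>lborel)"
    by (subst nn_integral_layer_cake[OF Y Y_range F F0 f_nonneg f, symmetric])
      (auto intro!: nn_integral_eq_integral[symmetric] int AE_I2 F_nonneg)
  have HL: "H 0 \<le> H L"
  proof (rule DERIV_nonneg_imp_nondecreasing[where f=H, OF L])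
    fix t assume "0 \<le> t" "t \<le> L"
    then show "\<exists>y. DERIV H t :> y \<and> 0 \<le> y"
      using H[of t] f_nonneg[of t] by (intro exI[of _ "f t * exp (- b * t)"]) auto
  qed
  have base: "(\<integral>\<^sup>+t. ennreal (c * (f t * exp (- b * t))) * indicator {0..<L} t \<partial>lborel) = ennreal (c * (H L - H 0))"
    if "0 \<le> c" for c
  proof -
    have "(\<integral>\<^sup>+t. ennreal (c * (f t * exp (- b * t))) * indicator {0..<L} t \<partial>lborel)
        = (\<integral>\<^sup>+t. ennreal (c * (f t * exp (- b * t))) * indicator {0..L} t \<partial>lborel)"
    proof (rule nn_integral_cong_AE)
      show "AE t in lborel. ennreal (c * (f t * exp (- b * t))) * indicator {0..<L} t =
          ennreal (c * (f t * exp (- b * t))) * indicator {0..L} t"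
        using AE_lborel_singleton[of "L"] by eventually_elim (auto split: split_indicator)
    qed
    also have "\<dots> = ennreal (c * H L - c * H 0)"
      using L H that f_nonneg
      by (intro nn_integral_FTC_Icc[where F="\<lambda>t. c * H t"]) (auto intro!: DERIV_cmult)
    finally show ?thesis by (simp add: algebra_simps)
  qed
  have "ennreal (lo * (H L - H 0)) \<le> ennreal (expectation (\<lambda>x. F (Y x)))"
    unfolding eq base[OF lo(1), symmetric]
  proof (rule nn_integral_mono)
    fix t
    show "ennreal (lo * (f t * exp (- b * t))) * indicator {0..<L} t
      \<le> ennreal (f t) * indicator {0..<L} t * emeasure M {x \<in> space M. t < Y x}"
    proof (cases "t \<in> {0..<L}")
      case True
      then have "f t * (lo * exp (- b * t)) \<le> f t * prob {x\<in>space M. Y x > t}"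
        using tail f_nonneg by (intro mult_left_mono) auto
      then show ?thesis using True f_nonneg[of t]
        by (auto simp: emeasure_eq_measure ennreal_mult[symmetric] algebra_simps intro!: ennreal_leI)
    qed auto
  qed
  then show "lo * (H L - H 0) \<le> expectation (\<lambda>x. F (Y x))"
    by (subst (asm) ennreal_le_iff) (auto intro!: integral_nonneg_AE AE_I2 F_nonneg)
  have "ennreal (expectation (\<lambda>x. F (Y x))) \<le> ennreal (hi * (H L - H 0))"
    unfolding eq base[OF lo(2), symmetric]
  proof (rule nn_integral_mono)
    fix t
    show "ennreal (f t) * indicator {0..<L} t * emeasure M {x \<in> space M. t < Y x} \<le>
        ennreal (hi * (f t * exp (- b * t))) * indicator {0..<L} t"
    proof (cases "t \<in> {0..<L}")
      case True
      then have "f t * prob {x\<in>space M. Y x > t} \<le> f t * (hi * exp (- b * t))"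
        using tail f_nonneg by (intro mult_left_mono) auto
      then show ?thesis using True f_nonneg[of t]
        by (auto simp: emeasure_eq_measure ennreal_mult[symmetric] algebra_simps intro!: ennreal_leI)
    qed auto
  qed
  then show "expectation (\<lambda>x. F (Y x)) \<le> hi * (H L - H 0)"
    using HL lo(2) by (subst (asm) ennreal_le_iff) (auto intro!: mult_nonneg_nonneg)
qed

text \<open>Integrating the tail inequality over the range of the variables: a uniform gap
  \<open>c\<close> between the tails costs only \<open>c * L\<close> in the mean. With
  \<open>L\<close> logarithmic in the threshold, this is the cheap way to compare two shifts of the
  log excess.\<close>

lemma (in prob_space) expectation_le_of_tail_le:
  fixes Y Z :: "'a \<Rightarrow> real"
  assumes Y[measurable]: "Y \<in> borel_measurable M" and Z[measurable]: "Z \<in> borel_measurable M"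
    and Y_range: "\<And>x. x \<in> space M \<Longrightarrow> 0 \<le> Y x \<and> Y x \<le> L"
    and Z_range: "\<And>x. x \<in> space M \<Longrightarrow> 0 \<le> Z x \<and> Z x \<le> L"
    and tail: "\<And>t. 0 \<le> t \<Longrightarrow> t < L \<Longrightarrow>
      prob {x\<in>space M. Y x > t} \<le> prob {x\<in>space M. Z x > t} + c"
    and c: "0 \<le> c" and L: "0 \<le> L"
  shows "expectation Y \<le> expectation Z + c * L"
proof -
  have int: "integrable M Y" "integrable M Z"
    using Y_range Z_range by (auto intro!: integrable_const_bound[where B=L] AE_I2)
  have eq: "ennreal (expectation X) = (\<integral>\<^sup>+t. indicator {0..<L} t * emeasure M {x\<in>space M. X x > t} \<partial>lborel)"
    if [measurable]: "X \<in> borel_measurable M" and X: "\<And>x. x \<in> space M \<Longrightarrow> 0 \<le> X x \<and> X x \<le> L" "integrable M X" for X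
  proof -
    have "ennreal (expectation X) = (\<integral>\<^sup>+x. ennreal (X x) \<partial>M)"
      using X by (intro nn_integral_eq_integral[symmetric]) auto
    also have "\<dots> = (\<integral>\<^sup>+t. ennreal 1 * indicator {0..<L} t * emeasure M {x\<in>space M. X x > t} \<partial>lborel)"
      using X by (intro nn_integral_layer_cake[where F="\<lambda>x. x" and f="\<lambda>_. 1"]) auto
    finally show ?thesis by simp
  qed
  note eqY = eq[OF Y Y_range int(1), simplified] and eqZ = eq[OF Z Z_range int(2), simplified]
  have "ennreal (expectation Y) \<le> (\<integral>\<^sup>+t. indicator {0..<L} t * emeasure M {x\<in>space M. Z x > t} + ennreal c * indicator {0..<L} t \<partial>lborel)"
    unfolding eqY
  proof (rule nn_integral_mono)
    fix t
    show "indicator {0..<L} t * emeasure M {x \<in> space M. t < Y x}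
         \<le> indicator {0..<L} t * emeasure M {x \<in> space M. t < Z x} + ennreal c * indicator {0..<L} t"
    proof (cases "t \<in> {0..<L}")
      case True
      with tail[of t] c show ?thesis
        by (auto simp: emeasure_eq_measure ennreal_plus[symmetric] simp del: ennreal_plus intro!: ennreal_leI)
    qed auto
  qed
  also have "\<dots> = ennreal (expectation Z) + ennreal c * ennreal L"
    unfolding eqZ using L
    by (subst nn_integral_add) (auto simp: nn_integral_cmult_indicator)
  also have "\<dots> = ennreal (expectation Z + c * L)"
    using c L Z_range by (subst ennreal_plus) (auto simp: ennreal_mult intro!: integral_nonneg_AE)
  finally show ?thesis
    using c L Z_range by (subst (asm) ennreal_le_iff) (auto intro!: add_nonneg_nonneg integral_nonneg_AE)
qed

lemma (in prob_space) square_sum_indep_centered: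
  fixes X :: "'i \<Rightarrow> 'a \<Rightarrow> real"
  assumes "finite A" "indep_vars (\<lambda>_. borel) X A"
    and "\<And>i. i \<in> A \<Longrightarrow> integrable M (\<lambda>\<omega>. (X i \<omega>)\<^sup>2)"
    and "\<And>i. i \<in> A \<Longrightarrow> expectation (X i) = 0"
  shows "integrable M (\<lambda>\<omega>. (\<Sum>i\<in>A. X i \<omega>)\<^sup>2) \<and>
    expectation (\<lambda>\<omega>. (\<Sum>i\<in>A. X i \<omega>)\<^sup>2) = (\<Sum>i\<in>A. expectation (\<lambda>\<omega>. (X i \<omega>)\<^sup>2))"
  using assms
proof (induction A rule: finite_induct)
  case empty
  then show ?case by simp
next
  case (insert x A)
  have rv[measurable]: "X i \<in> borel_measurable M" if "i \<in> insert x A" for i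
    using insert.prems(1) that by (auto simp: indep_vars_def)
  have IH: "integrable M (\<lambda>\<omega>. (\<Sum>i\<in>A. X i \<omega>)\<^sup>2)"
    "expectation (\<lambda>\<omega>. (\<Sum>i\<in>A. X i \<omega>)\<^sup>2) = (\<Sum>i\<in>A. expectation (\<lambda>\<omega>. (X i \<omega>)\<^sup>2))"
    using insert.IH insert.prems indep_vars_subset[OF insert.prems(1), of A] by auto
  have Sm[measurable]: "(\<lambda>\<omega>. \<Sum>i\<in>A. X i \<omega>) \<in> borel_measurable M" by (intro borel_measurable_sum) (auto intro: rv)
  have iX: "integrable M (X i)" if "i \<in> insert x A" for i
    by (rule square_integrable_imp_integrable[OF rv[OF that] insert.prems(2)[OF that]])
  have iS: "integrable M (\<lambda>\<omega>. \<Sum>i\<in>A. X i \<omega>)" using iX by auto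
  have ind: "indep_var borel (X x) borel (\<lambda>\<omega>. \<Sum>i\<in>A. X i \<omega>)"
    using insert.prems(1) insert.hyps by (intro indep_vars_sum) auto
  have prod: "integrable M (\<lambda>\<omega>. X x \<omega> * (\<Sum>i\<in>A. X i \<omega>))"
     "expectation (\<lambda>\<omega>. X x \<omega> * (\<Sum>i\<in>A. X i \<omega>)) = 0"
    using indep_var_integrable[OF ind iX iS] indep_var_lebesgue_integral[OF ind iX iS] insert.prems(3)
    by auto
  have ex: "(\<Sum>i\<in>insert x A. X i \<omega>)\<^sup>2 = (X x \<omega>)\<^sup>2 + 2 * (X x \<omega> * (\<Sum>i\<in>A. X i \<omega>)) + (\<Sum>i\<in>A. X i \<omega>)\<^sup>2" for \<omega>
    using insert.hyps by (simp add: power2_eq_square algebra_simps)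
  show ?case
    unfolding ex using prod IH insert.prems insert.hyps by simp
qed

text \<open>The variance of each summand is \<open>v - m\<^sup>2\<close>; dropping
  \<open>m\<^sup>2\<close> is harmless in the applications, where raw second moments already have
  the right order.\<close>

lemma (in prob_space) square_sum_iid_le:
  fixes X :: "'i \<Rightarrow> 'a \<Rightarrow> real" and m v :: real
  assumes A: "finite A" and ind: "indep_vars (\<lambda>_. borel) X A"
    and int: "\<And>i. i \<in> A \<Longrightarrow> integrable M (\<lambda>\<omega>. (X i \<omega>)\<^sup>2)"
    and m: "\<And>i. i \<in> A \<Longrightarrow> expectation (X i) = m"
    and v: "\<And>i. i \<in> A \<Longrightarrow> expectation (\<lambda>\<omega>. (X i \<omega>)\<^sup>2) = v"
  shows "integrable M (\<lambda>\<omega>. ((\<Sum>i\<in>A. X i \<omega>) - card A * m)\<^sup>2)"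
    and "expectation (\<lambda>\<omega>. ((\<Sum>i\<in>A. X i \<omega>) - card A * m)\<^sup>2) \<le> card A * v"
proof -
  have rv[measurable]: "X i \<in> borel_measurable M" if "i \<in> A" for i
    using ind that by (auto simp: indep_vars_def)
  have iX: "integrable M (X i)" if "i \<in> A" for i
    by (rule square_integrable_imp_integrable[OF rv[OF that] int[OF that]])
  have eq: "(\<Sum>i\<in>A. X i \<omega>) - card A * m = (\<Sum>i\<in>A. X i \<omega> - m)" for \<omega>
    by (simp add: sum_subtractf)
  have var: "expectation (\<lambda>\<omega>. (X i \<omega> - m)\<^sup>2) = v - m\<^sup>2" if "i \<in> A" for i
    using variance_eq[OF iX[OF that] int[OF that]] m[OF that] v[OF that] by simp
  have i2: "integrable M (\<lambda>\<omega>. (X i \<omega> - m)\<^sup>2)" if "i \<in> A" for i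
    unfolding power2_diff using iX[OF that] int[OF that] by auto
  have c: "integrable M (\<lambda>\<omega>. (\<Sum>i\<in>A. X i \<omega> - m)\<^sup>2) \<and>
    expectation (\<lambda>\<omega>. (\<Sum>i\<in>A. X i \<omega> - m)\<^sup>2) = (\<Sum>i\<in>A. expectation (\<lambda>\<omega>. (X i \<omega> - m)\<^sup>2))"
    using i2 iX m prob_space
    by (intro square_sum_indep_centered A indep_vars_compose2[OF ind]) auto
  then show "integrable M (\<lambda>\<omega>. ((\<Sum>i\<in>A. X i \<omega>) - card A * m)\<^sup>2)" by (simp add: eq)
  have "expectation (\<lambda>\<omega>. ((\<Sum>i\<in>A. X i \<omega>) - card A * m)\<^sup>2) = card A * (v - m\<^sup>2)"
    unfolding eq using c var by simp
  also have "\<dots> \<le> card A * v" by (intro mult_left_mono) auto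
  finally show "expectation (\<lambda>\<omega>. ((\<Sum>i\<in>A. X i \<omega>) - card A * m)\<^sup>2) \<le> card A * v" .
qed

section \<open>Limit theorems via characteristic functions\<close>

text \<open>A Lyapunov type limit theorem for rows that need not be centred: it is enough that
  \<open>n\<close> times the mean vanishes. The characteristic function of one summand is compared
  with \<open>w n\<close>, and \<open>norm_power_diff\<close> turns an error per factor into
  \<open>n\<close> times that error for the product.\<close>

lemma (in prob_space) char_sum_row_iid_tendsto:
  fixes X :: "nat \<Rightarrow> nat \<Rightarrow> 'a \<Rightarrow> real" and \<mu> :: "nat \<Rightarrow> real measure"
  assumes ind: "\<And>n. indep_vars (\<lambda>_. borel) (X n) {1..n}"
    and distr: "\<And>n i. i \<in> {1..n} \<Longrightarrow> distr M borel (X n i) = \<mu> n"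
    and \<mu>: "\<And>n. real_distribution (\<mu> n)"
    and int: "\<And>n k. k \<le> 3 \<Longrightarrow> integrable (\<mu> n) (\<lambda>x. x ^ k)"
    and m1: "(\<lambda>n. n * (\<integral>x. x \<partial>\<mu> n)) \<longlonglongrightarrow> 0"
    and m2: "(\<lambda>n. n * (\<integral>x. x\<^sup>2 \<partial>\<mu> n)) \<longlonglongrightarrow> v"
    and m3: "(\<lambda>n. n * (\<integral>x. \<bar>x\<bar> ^ 3 \<partial>\<mu> n)) \<longlonglongrightarrow> 0"
    and v: "0 \<le> v"
  shows "(\<lambda>n. char (distr M borel (\<lambda>\<omega>. \<Sum>i=1..n. X n i \<omega>)) t) \<longlonglongrightarrow> complex_of_real (exp (- (t\<^sup>2 * v) / 2))"
proof -
  \<comment> \<open>The second order Taylor polynomial of the characteristic function of a variable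
    with mean 0 and variance \<open>v / n\<close>.\<close>
  define w where "w n = 1 + (- (t\<^sup>2 * v) / 2) / real n" for n
  have char_eq: "char (distr M borel (\<lambda>\<omega>. \<Sum>i=1..n. X n i \<omega>)) t = char (\<mu> n) t ^ n" for n
    by (subst char_distr_sum[OF ind]) (simp add: distr)
  \<comment> \<open>The three summands are \<open>n\<close> times the contributions of the nonzero
    mean, of the second moment differing from \<open>v / n\<close>, and of the Taylor
    remainder.\<close>
  define E where "E n = \<bar>t\<bar> * \<bar>n * (\<integral>x. x \<partial>\<mu> n)\<bar> + t\<^sup>2 / 2 * \<bar>n * (\<integral>x. x\<^sup>2 \<partial>\<mu> n) - v\<bar>
      + \<bar>t\<bar>^3 / 6 * (n * (\<integral>x. \<bar>x\<bar> ^ 3 \<partial>\<mu> n))" for n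
  have E0: "E \<longlonglongrightarrow> 0"
    unfolding E_def
    by (rule tendsto_eq_intros m1 m2 m3 tendsto_rabs_zero LIM_zero refl | simp)+
  have bound: "real n * norm (char (\<mu> n) t - of_real (w n)) \<le> E n" if n: "n \<ge> 1" for n
  proof -
    interpret \<mu>: real_distribution "\<mu> n" by (rule \<mu>)
    have sum2: "(\<Sum>k\<le>2. ((\<i> * complex_of_real t) ^ k / fact k) * of_real (\<mu>.expectation (\<lambda>x. x ^ k)))
      = 1 + \<i> * t * \<mu>.expectation (\<lambda>x. x) - t\<^sup>2 / 2 * \<mu>.expectation (\<lambda>x. x\<^sup>2)"
      using \<mu>.prob_space by (simp add: numeral_2_eq_2 power_mult_distrib)
    have "norm (char (\<mu> n) t - (\<Sum>k\<le>2. ((\<i> * complex_of_real t) ^ k / fact k) * of_real (\<mu>.expectation (\<lambda>x. x ^ k))))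
      \<le> (\<bar>t\<bar>^2 / fact (Suc 2)) * \<mu>.expectation (\<lambda>x. min (2 * \<bar>x\<bar>^2 * Suc 2) (\<bar>t\<bar> * \<bar>x\<bar>^Suc 2))"
      using int by (intro \<mu>.char_approx2) auto
    also have "\<dots> \<le> (\<bar>t\<bar>^2 / fact (Suc 2)) * \<mu>.expectation (\<lambda>x. \<bar>t\<bar> * \<bar>x\<bar>^3)"
    proof (intro mult_left_mono integral_mono_AE' AE_I2)
      show "integrable (\<mu> n) (\<lambda>x. \<bar>t\<bar> * \<bar>x\<bar> ^ 3)"
        using integrable_abs[OF int[of 3 n]] by (auto simp: power_abs)
    qed (auto simp: numeral_3_eq_3)
    also have "\<dots> = \<bar>t\<bar>^3 / 6 * \<mu>.expectation (\<lambda>x. \<bar>x\<bar>^3)"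
      by (simp add: fact_numeral power2_eq_square power3_eq_cube)
    finally have 1: "norm (char (\<mu> n) t - (1 + \<i> * t * \<mu>.expectation (\<lambda>x. x) - t\<^sup>2 / 2 * \<mu>.expectation (\<lambda>x. x\<^sup>2)))
      \<le> \<bar>t\<bar>^3 / 6 * \<mu>.expectation (\<lambda>x. \<bar>x\<bar>^3)"
      unfolding sum2 .
    have "norm ((1 + \<i> * t * \<mu>.expectation (\<lambda>x. x) - t\<^sup>2 / 2 * \<mu>.expectation (\<lambda>x. x\<^sup>2)) - of_real (w n))
      = norm (\<i> * of_real (t * \<mu>.expectation (\<lambda>x. x)) + of_real (- (t\<^sup>2 / 2 * (\<mu>.expectation (\<lambda>x. x\<^sup>2) - v / n))))"
      unfolding w_def by (rule arg_cong[where f=norm]) (simp add: algebra_simps)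
    also have "\<dots> \<le> \<bar>t * \<mu>.expectation (\<lambda>x. x)\<bar> + \<bar>t\<^sup>2 / 2 * (\<mu>.expectation (\<lambda>x. x\<^sup>2) - v / n)\<bar>"
      by (rule order_trans[OF norm_triangle_ineq]) (simp add: norm_mult del: of_real_mult of_real_minus)
    finally have 2: "norm ((1 + \<i> * t * \<mu>.expectation (\<lambda>x. x) - t\<^sup>2 / 2 * \<mu>.expectation (\<lambda>x. x\<^sup>2)) - of_real (w n))
      \<le> \<bar>t * \<mu>.expectation (\<lambda>x. x)\<bar> + \<bar>t\<^sup>2 / 2 * (\<mu>.expectation (\<lambda>x. x\<^sup>2) - v / n)\<bar>" .
    have "norm (char (\<mu> n) t - of_real (w n)) \<le> \<bar>t\<bar>^3 / 6 * \<mu>.expectation (\<lambda>x. \<bar>x\<bar>^3)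
      + (\<bar>t * \<mu>.expectation (\<lambda>x. x)\<bar> + \<bar>t\<^sup>2 / 2 * (\<mu>.expectation (\<lambda>x. x\<^sup>2) - v / n)\<bar>)"
      by (rule norm_diff_triangle_le[OF 1 2])
    then have "real n * norm (char (\<mu> n) t - of_real (w n)) \<le> real n * (\<bar>t\<bar>^3 / 6 * \<mu>.expectation (\<lambda>x. \<bar>x\<bar>^3)
      + (\<bar>t * \<mu>.expectation (\<lambda>x. x)\<bar> + \<bar>t\<^sup>2 / 2 * (\<mu>.expectation (\<lambda>x. x\<^sup>2) - v / n)\<bar>))"
      by (intro mult_left_mono) auto
    also have "\<dots> = E n"
    proof -
      have "real n * \<bar>\<mu>.expectation (\<lambda>x. x\<^sup>2) - v / n\<bar> = \<bar>real n * \<mu>.expectation (\<lambda>x. x\<^sup>2) - v\<bar>"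
      proof -
        have "real n * \<bar>\<mu>.expectation (\<lambda>x. x\<^sup>2) - v / n\<bar> = \<bar>real n * (\<mu>.expectation (\<lambda>x. x\<^sup>2) - v / n)\<bar>"
          by (simp add: abs_mult)
        also have "real n * (\<mu>.expectation (\<lambda>x. x\<^sup>2) - v / n) = real n * \<mu>.expectation (\<lambda>x. x\<^sup>2) - v"
          using n by (simp add: right_diff_distrib)
        finally show ?thesis .
      qed
      then show ?thesis
        unfolding E_def abs_mult distrib_left
        by (simp add: mult.left_commute[of "real n" "t\<^sup>2 / 2"] mult.left_commute[of "real n" "t\<^sup>2"] abs_mult)
    qed
    finally show ?thesis .
  qed
  have "(\<lambda>n. norm (char (\<mu> n) t ^ n - of_real (w n) ^ n)) \<longlonglongrightarrow> 0"
  proof (rule tendsto_sandwich[OF _ _ tendsto_const E0])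
    \<comment> \<open>Ensures \<open>\<bar>w n\<bar> \<le> 1\<close>; the power comparison needs
      both bases in the unit disc.\<close>
    have "eventually (\<lambda>n. real n \<ge> t\<^sup>2 * v) sequentially"
      using filterlim_real_sequentially by (simp add: filterlim_at_top)
    then show "\<forall>\<^sub>F n in sequentially. norm (char (\<mu> n) t ^ n - of_real (w n) ^ n) \<le> E n"
      using eventually_ge_at_top[of 1]
    proof eventually_elim
      case (elim n)
      have "0 \<le> t\<^sup>2 * v / (2 * n)" "t\<^sup>2 * v / (2 * n) \<le> 1"
        using elim v by (auto simp: divide_le_eq intro!: divide_nonneg_nonneg mult_nonneg_nonneg)
      then have "\<bar>w n\<bar> \<le> 1" unfolding w_def by simp
      then have "norm (char (\<mu> n) t ^ n - of_real (w n) ^ n) \<le> n * norm (char (\<mu> n) t - of_real (w n))"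
        using real_distribution.cmod_char_le_1[OF \<mu>] by (intro norm_power_diff) auto
      with bound[of n] elim show ?case by simp
    qed
  qed simp
  then have *: "(\<lambda>n. char (\<mu> n) t ^ n - of_real (w n) ^ n) \<longlonglongrightarrow> 0"
    by (simp add: tendsto_norm_zero_iff)
  have "(\<lambda>n. complex_of_real (w n ^ n)) \<longlonglongrightarrow> complex_of_real (exp (- (t\<^sup>2 * v) / 2))"
    unfolding w_def
    by (rule isCont_tendsto_compose [OF _ tendsto_exp_limit_sequentially]) auto
  with * show ?thesis
    unfolding char_eq using Lim_transform by fastforce
qed

lemma (in prob_space) prob_abs_gt_le:
  fixes Y :: "'a \<Rightarrow> real"
  assumes "integrable M Y" "0 < e"
  shows "prob {\<omega>\<in>space M. \<bar>Y \<omega>\<bar> > e} \<le> expectation (\<lambda>\<omega>. \<bar>Y \<omega>\<bar>) / e"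
proof -
  have [measurable]: "Y \<in> borel_measurable M" using assms by auto
  have "prob {\<omega>\<in>space M. \<bar>Y \<omega>\<bar> > e} \<le> prob {\<omega>\<in>space M. \<bar>Y \<omega>\<bar> \<ge> e}"
    by (rule finite_measure_mono) auto
  also have "\<dots> \<le> expectation (\<lambda>\<omega>. \<bar>Y \<omega>\<bar>) / e"
    using assms by (intro integral_Markov_inequality_measure[where A="{}"]) auto
  finally show ?thesis .
qed

text \<open>Two values of the function exp(i t x) differ by at most \<open>\<bar>t\<bar> * e\<close>
  when their arguments differ by at most \<open>e\<close>, and by at most 2 in any case. Splitting
  the expectation accordingly gives the claim.\<close>

lemma (in prob_space) char_tendsto_of_prob_diff:
  fixes W Z :: "nat \<Rightarrow> 'a \<Rightarrow> real"
  assumes W[measurable]: "\<And>n. W n \<in> borel_measurable M" and Z[measurable]: "\<And>n. Z n \<in> borel_measurable M"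
    and lim: "(\<lambda>n. char (distr M borel (Z n)) t) \<longlonglongrightarrow> l"
    and diff: "\<And>e. 0 < e \<Longrightarrow> (\<lambda>n. prob {\<omega>\<in>space M. \<bar>W n \<omega> - Z n \<omega>\<bar> > e}) \<longlonglongrightarrow> 0"
  shows "(\<lambda>n. char (distr M borel (W n)) t) \<longlonglongrightarrow> l"
proof -
  have bound: "norm (char (distr M borel (W n)) t - char (distr M borel (Z n)) t)
    \<le> \<bar>t\<bar> * e + 2 * prob {\<omega>\<in>space M. \<bar>W n \<omega> - Z n \<omega>\<bar> > e}" if e: "0 < e" for n e
  proof -
    have int: "integrable M (\<lambda>\<omega>. iexp (t * Y \<omega>))" if [measurable]: "Y \<in> borel_measurable M" for Y
      by (intro integrable_const_bound[where B=1]) auto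
    have "norm (char (distr M borel (W n)) t - char (distr M borel (Z n)) t)
      = norm (\<integral>\<omega>. iexp (t * W n \<omega>) - iexp (t * Z n \<omega>) \<partial>M)"
      unfolding char_def using int[OF W, of n] int[OF Z, of n]
      by (simp add: integral_distr del: of_real_mult)
    also have "\<dots> \<le> (\<integral>\<omega>. norm (iexp (t * W n \<omega>) - iexp (t * Z n \<omega>)) \<partial>M)"
      by (rule integral_norm_bound)
    also have "\<dots> \<le> (\<integral>\<omega>. \<bar>t\<bar> * e + 2 * indicator {\<omega>\<in>space M. \<bar>W n \<omega> - Z n \<omega>\<bar> > e} \<omega> \<partial>M)"
    proof (rule integral_mono)
      show "integrable M (\<lambda>\<omega>. norm (iexp (t * W n \<omega>) - iexp (t * Z n \<omega>)))"
        using int[OF W, of n] int[OF Z, of n] by (intro integrable_norm Bochner_Integration.integrable_diff) auto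
      show "integrable M (\<lambda>\<omega>. \<bar>t\<bar> * e + 2 * indicator {\<omega>\<in>space M. \<bar>W n \<omega> - Z n \<omega>\<bar> > e} \<omega> :: real)"
        by (rule integrable_const_bound[where B="\<bar>t\<bar> * e + 2"]) (use e in \<open>auto split: split_indicator\<close>)
      fix \<omega> assume \<omega>: "\<omega> \<in> space M"
      show "norm (iexp (t * W n \<omega>) - iexp (t * Z n \<omega>)) \<le> \<bar>t\<bar> * e + 2 * indicator {\<omega>\<in>space M. \<bar>W n \<omega> - Z n \<omega>\<bar> > e} \<omega>"
      proof (cases "\<bar>W n \<omega> - Z n \<omega>\<bar> > e")
        case True
        have "norm (iexp (t * W n \<omega>) - iexp (t * Z n \<omega>)) \<le> norm (iexp (t * W n \<omega>)) + norm (iexp (t * Z n \<omega>))"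
          by (rule norm_triangle_ineq4)
        also have "\<dots> = 2" by (simp del: of_real_mult)
        also have "\<dots> \<le> \<bar>t\<bar> * e + 2 * indicator {\<omega>\<in>space M. \<bar>W n \<omega> - Z n \<omega>\<bar> > e} \<omega>"
          using True e \<omega> by simp
        finally show ?thesis .
      next
        case False
        let ?x = "t * (W n \<omega> - Z n \<omega>)"
        have "iexp (t * W n \<omega>) - iexp (t * Z n \<omega>) = iexp (t * Z n \<omega>) * (iexp ?x - 1)"
          by (simp add: exp_add[symmetric] algebra_simps)
        then have "norm (iexp (t * W n \<omega>) - iexp (t * Z n \<omega>)) = norm (iexp ?x - 1)"
          by (simp add: norm_mult del: of_real_mult)
        also have "\<dots> \<le> \<bar>?x\<bar>"
          using iexp_approx1[of ?x 0] by simp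
        also have "\<dots> \<le> \<bar>t\<bar> * e" unfolding abs_mult using False by (intro mult_left_mono) auto
        finally show ?thesis using False by simp
      qed
    qed
    also have "\<dots> = \<bar>t\<bar> * e + 2 * prob {\<omega>\<in>space M. \<bar>W n \<omega> - Z n \<omega>\<bar> > e}"
    proof -
      have [measurable]: "{\<omega>\<in>space M. \<bar>W n \<omega> - Z n \<omega>\<bar> > e} \<in> sets M" by measurable
      have "integrable M (indicator {\<omega>\<in>space M. \<bar>W n \<omega> - Z n \<omega>\<bar> > e} :: _ \<Rightarrow> real)"
        by (rule integrable_real_indicator) (auto simp: emeasure_eq_measure)
      then show ?thesis
        by (subst Bochner_Integration.integral_add) (auto simp: prob_space)
    qed
    finally show ?thesis .
  qed
  have "(\<lambda>n. char (distr M borel (W n)) t - char (distr M borel (Z n)) t) \<longlonglongrightarrow> 0"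
  proof (rule tendstoI)
    fix \<gamma> :: real assume \<gamma>: "0 < \<gamma>"
    \<comment> \<open>Half of \<open>\<gamma>\<close> is spent on \<open>\<bar>t\<bar> * e\<close>
      and half on twice the probability; the summand 1 covers \<open>t = 0\<close>.\<close>
    define e where "e = \<gamma> / (2 * (\<bar>t\<bar> + 1))"
    have e: "0 < e" "\<bar>t\<bar> * e < \<gamma> / 2"
      using \<gamma> unfolding e_def by (auto simp: field_simps intro!: add_pos_nonneg)
    have "eventually (\<lambda>n. prob {\<omega>\<in>space M. \<bar>W n \<omega> - Z n \<omega>\<bar> > e} < \<gamma> / 4) sequentially"
      using order_tendstoD(2)[OF diff[OF e(1)], of "\<gamma> / 4"] \<gamma> by auto
    then show "\<forall>\<^sub>F n in sequentially. dist (char (distr M borel (W n)) t - char (distr M borel (Z n)) t) 0 < \<gamma>"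
    proof eventually_elim
      case (elim n)
      then show ?case using bound[OF e(1), of n] e(2) by simp
    qed
  qed
  with lim show ?thesis using Lim_transform by fastforce
qed

text \<open>Slutsky's theorem for quotients. Writing the difference as
  \<open>(A' - A) / D' + A (m - D') / (m D')\<close>, it is small off an event where one of the
  differences or \<open>\<bar>A\<bar>\<close> is large. The value of \<open>W\<close> where \<open>D' = 0\<close> is left open
  because there an estimator \<open>s * (x / D' - b)\<close> takes the junk value \<open>- s * b\<close>, not \<open>A' / D'\<close>.\<close>

lemma (in prob_space) quotient_prob_tendsto:
  fixes A A' D D' W :: "nat \<Rightarrow> 'a \<Rightarrow> real"
  assumes [measurable]: "\<And>n. A n \<in> borel_measurable M" "\<And>n. A' n \<in> borel_measurable M"
     "\<And>n. D n \<in> borel_measurable M" "\<And>n. D' n \<in> borel_measurable M"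
    and AA: "\<And>n. integrable M (\<lambda>\<omega>. A' n \<omega> - A n \<omega>)" "(\<lambda>n. expectation (\<lambda>\<omega>. \<bar>A' n \<omega> - A n \<omega>\<bar>)) \<longlonglongrightarrow> 0"
    and DD: "\<And>n. integrable M (\<lambda>\<omega>. D' n \<omega> - D n \<omega>)" "(\<lambda>n. expectation (\<lambda>\<omega>. \<bar>D' n \<omega> - D n \<omega>\<bar>)) \<longlonglongrightarrow> 0"
    and Dm: "\<And>n. integrable M (\<lambda>\<omega>. (D n \<omega> - d n)\<^sup>2)" "(\<lambda>n. expectation (\<lambda>\<omega>. (D n \<omega> - d n)\<^sup>2)) \<longlonglongrightarrow> 0"
    and d: "d \<longlonglongrightarrow> m" and m: "0 < m"
    and A2: "\<And>n. integrable M (\<lambda>\<omega>. (A n \<omega>)\<^sup>2)" "\<forall>\<^sub>F n in sequentially. expectation (\<lambda>\<omega>. (A n \<omega>)\<^sup>2) \<le> K"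
    and W: "\<And>n \<omega>. D' n \<omega> \<noteq> 0 \<Longrightarrow> W n \<omega> = A' n \<omega> / D' n \<omega>"
    and e: "0 < e"
  shows "(\<lambda>n. prob {\<omega>\<in>space M. \<bar>W n \<omega> - A n \<omega> / m\<bar> > e}) \<longlonglongrightarrow> 0"
proof (rule tendstoI)
  fix \<gamma> :: real assume \<gamma>: "0 < \<gamma>"
  \<comment> \<open>Makes the Markov bound \<open>\<bar>K\<bar> / R\<^sup>2\<close> for the event
    that \<open>\<bar>A n\<bar>\<close> exceeds \<open>R\<close> smaller than
    \<open>\<gamma> / 4\<close>.\<close>
  define R where "R = sqrt (4 * (\<bar>K\<bar> + 1) / \<gamma>)"
  have R: "0 < R" "R\<^sup>2 = 4 * (\<bar>K\<bar> + 1) / \<gamma>"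
    using \<gamma> unfolding R_def by (auto intro!: divide_pos_pos add_nonneg_pos simp: real_sqrt_pow2)
  \<comment> \<open>The first entry keeps \<open>D'\<close> at least \<open>m / 2\<close>. On the
    good event the error of the quotient is then at most
    \<open>\<eta> * (2 / m + 2 * R / m\<^sup>2)\<close>, and the second entry bounds this by
    \<open>e / 2\<close>. For \<open>D'\<close> the budget \<open>\<eta>\<close> is split into
    three: \<open>D' - D\<close>, \<open>D - d\<close> and \<open>d - m\<close>.\<close>
  define \<eta> where "\<eta> = min (m / 2) (e / (2 * (2 / m + 2 * R / m\<^sup>2)))"
  have c: "0 < 2 / m + 2 * R / m\<^sup>2" using m R by (auto intro!: add_pos_pos)
  have "0 < e / (2 * (2 / m + 2 * R / m\<^sup>2))" using e c by (intro divide_pos_pos mult_pos_pos) auto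
  then have \<eta>: "0 < \<eta>" "\<eta> \<le> m / 2" using m unfolding \<eta>_def by (auto simp only: min_less_iff_conj min.cobounded1 half_gt_zero)
  have half: "e / (2 * x) * x = e / 2" if "0 < x" for x :: real using that by simp
  have "\<eta> * (2 / m + 2 * R / m\<^sup>2) \<le> e / (2 * (2 / m + 2 * R / m\<^sup>2)) * (2 / m + 2 * R / m\<^sup>2)"
    using c unfolding \<eta>_def by (intro mult_right_mono) auto
  also have "\<dots> = e / 2" by (rule half[OF c])
  finally have \<eta>e: "\<eta> * (2 / m + 2 * R / m\<^sup>2) < e" using e by linarith
  let ?B1 = "\<lambda>n. {\<omega>\<in>space M. \<bar>A' n \<omega> - A n \<omega>\<bar> > \<eta>}"
  let ?B2 = "\<lambda>n. {\<omega>\<in>space M. \<bar>D' n \<omega> - D n \<omega>\<bar> > \<eta> / 3}"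
  let ?B3 = "\<lambda>n. {\<omega>\<in>space M. \<bar>(D n \<omega> - d n)\<^sup>2\<bar> > (\<eta> / 3)\<^sup>2}"
  let ?B4 = "\<lambda>n. {\<omega>\<in>space M. \<bar>(A n \<omega>)\<^sup>2\<bar> > R\<^sup>2}"
  have ev: "\<forall>\<^sub>F n in sequentially. f n / c < \<gamma> / 4" if "f \<longlonglongrightarrow> 0" "c > 0" for f :: "nat \<Rightarrow> real" and c
    using order_tendstoD(2)[OF that(1), of "\<gamma> / 4 * c"] \<gamma> that(2) by (simp add: divide_less_eq)
  have 1: "\<forall>\<^sub>F n in sequentially. prob (?B1 n) < \<gamma> / 4"
    using ev[OF AA(2) \<eta>(1)]
    by eventually_elim (rule le_less_trans[OF prob_abs_gt_le[OF AA(1) \<eta>(1)]])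
  have 2: "\<forall>\<^sub>F n in sequentially. prob (?B2 n) < \<gamma> / 4"
  proof -
    have \<eta>3: "0 < \<eta> / 3" using \<eta> by simp
    show ?thesis using ev[OF DD(2) \<eta>3]
      by eventually_elim (rule le_less_trans[OF prob_abs_gt_le[OF DD(1) \<eta>3]])
  qed
  have 3: "\<forall>\<^sub>F n in sequentially. prob (?B3 n) < \<gamma> / 4"
  proof -
    have \<eta>3: "0 < (\<eta> / 3)\<^sup>2" using \<eta> by simp
    show ?thesis using ev[OF Dm(2) \<eta>3]
      by eventually_elim (rule le_less_trans[OF prob_abs_gt_le[OF Dm(1) \<eta>3]], simp only: abs_power2)
  qed
  have 4: "\<forall>\<^sub>F n in sequentially. prob (?B4 n) < \<gamma> / 4"
    using A2(2)
  proof eventually_elim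
    case (elim n)
    have "prob (?B4 n) \<le> expectation (\<lambda>\<omega>. \<bar>(A n \<omega>)\<^sup>2\<bar>) / R\<^sup>2"
      by (rule prob_abs_gt_le[OF A2(1) zero_less_power[OF R(1)]])
    also have "\<dots> \<le> \<bar>K\<bar> / R\<^sup>2" using elim by (intro divide_right_mono) auto
    also have "\<dots> < \<gamma> / 4" unfolding R(2) using \<gamma> by (simp add: field_simps)
    finally show ?case .
  qed
  have 5: "\<forall>\<^sub>F n in sequentially. \<bar>d n - m\<bar> < \<eta> / 3"
    using tendstoD[OF d, of "\<eta> / 3"] \<eta> by (simp add: dist_real_def)
  show "\<forall>\<^sub>F n in sequentially. dist (prob {\<omega>\<in>space M. \<bar>W n \<omega> - A n \<omega> / m\<bar> > e}) 0 < \<gamma>"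
    using 1 2 3 4 5
  proof eventually_elim
    case (elim n)
    have sub: "{\<omega>\<in>space M. \<bar>W n \<omega> - A n \<omega> / m\<bar> > e} \<subseteq> ?B1 n \<union> (?B2 n \<union> (?B3 n \<union> ?B4 n))"
    proof (rule ccontr)
      assume "\<not> ?thesis"
      then obtain \<omega> where big: "\<bar>W n \<omega> - A n \<omega> / m\<bar> > e"
        and a: "\<bar>A' n \<omega> - A n \<omega>\<bar> \<le> \<eta>" and b: "\<bar>D' n \<omega> - D n \<omega>\<bar> \<le> \<eta> / 3"
        and c: "\<bar>(D n \<omega> - d n)\<^sup>2\<bar> \<le> (\<eta> / 3)\<^sup>2" and dd: "\<bar>(A n \<omega>)\<^sup>2\<bar> \<le> R\<^sup>2"
        by (auto simp only: subset_iff Un_iff mem_Collect_eq not_less[symmetric])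
      have c': "\<bar>D n \<omega> - d n\<bar> \<le> \<eta> / 3" using c \<eta> abs_le_square_iff[of "D n \<omega> - d n" "\<eta> / 3"] by simp
      have dd': "\<bar>A n \<omega>\<bar> \<le> R" using dd R abs_le_square_iff[of "A n \<omega>" "R"] by simp
      have D: "\<bar>D' n \<omega> - m\<bar> \<le> \<eta>" using b c' elim(5) by linarith
      then have D': "D' n \<omega> \<ge> m / 2" using \<eta> by linarith
      have pos: "0 < D' n \<omega>" using D' m by linarith
      have "A' n \<omega> / D' n \<omega> - A n \<omega> / m = (A' n \<omega> - A n \<omega>) / D' n \<omega> + A n \<omega> * (m - D' n \<omega>) / (m * D' n \<omega>)"
        using pos m by (simp add: field_simps)
      then have "\<bar>A' n \<omega> / D' n \<omega> - A n \<omega> / m\<bar> \<le> \<bar>A' n \<omega> - A n \<omega>\<bar> / D' n \<omega> + \<bar>A n \<omega>\<bar> * \<bar>m - D' n \<omega>\<bar> / (m * D' n \<omega>)"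
        using pos m by (metis abs_triangle_ineq abs_divide abs_mult abs_of_pos)
      also have "\<dots> \<le> \<eta> / (m / 2) + R * \<eta> / (m * (m / 2))"
        using a dd' D D' m \<eta> R by (intro add_mono frac_le mult_mono mult_pos_pos) auto
      also have "\<dots> = \<eta> * (2 / m + 2 * R / m\<^sup>2)"
        using m by (simp add: field_simps power2_eq_square)
      finally show False using big \<eta>e W[of n \<omega>] pos by auto
    qed
    have "prob {\<omega>\<in>space M. \<bar>W n \<omega> - A n \<omega> / m\<bar> > e} \<le> prob (?B1 n \<union> (?B2 n \<union> (?B3 n \<union> ?B4 n)))"
      by (rule finite_measure_mono[OF sub]) measurable
    also have "\<dots> \<le> prob (?B1 n) + prob (?B2 n \<union> (?B3 n \<union> ?B4 n))"
      by (rule measure_Un_le) measurable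
    also have "prob (?B2 n \<union> (?B3 n \<union> ?B4 n)) \<le> prob (?B2 n) + prob (?B3 n \<union> ?B4 n)"
      by (rule measure_Un_le) measurable
    also have "prob (?B3 n \<union> ?B4 n) \<le> prob (?B3 n) + prob (?B4 n)"
      by (rule measure_Un_le) measurable
    finally show ?case using elim by (simp add: measure_nonneg)
  qed
qed

lemma char_normal_density:
  assumes \<sigma>: "0 < \<sigma>"
  shows "char (density lborel (normal_density 0 \<sigma>)) t = complex_of_real (exp (- (t\<^sup>2 * \<sigma>\<^sup>2) / 2))"
proof -
  interpret S: prob_space std_normal_distribution
    by (rule prob_space_normal_density) simp
  have "distributed std_normal_distribution lborel (\<lambda>x. x) std_normal_density"
    unfolding distributed_def by (auto simp: distr_id2 intro!: distr_id2)
  then have "distributed std_normal_distribution lborel (\<lambda>x. 0 + \<sigma> * x) (normal_density (0 + \<sigma> * 0) (\<bar>\<sigma>\<bar> * 1))"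
    using \<sigma> by (intro S.normal_density_affine) auto
  then have "distr std_normal_distribution lborel (\<lambda>x. \<sigma> * x) = density lborel (normal_density 0 \<sigma>)"
    using \<sigma> by (simp add: distributed_def)
  then have "char (density lborel (normal_density 0 \<sigma>)) t = char (distr std_normal_distribution lborel (\<lambda>x. \<sigma> * x)) t"
    by simp
  also have "\<dots> = char std_normal_distribution (t * \<sigma>)"
    unfolding char_def by (subst integral_distr) (auto simp: mult_ac)
  finally show ?thesis by (simp add: char_std_normal_distribution power_mult_distrib)
qed

lemma (in prob_space) expectation_abs_sum_diff_le:
  fixes f h :: "nat \<Rightarrow> 'a \<Rightarrow> real"
  assumes int: "\<And>i. i \<in> {1..N} \<Longrightarrow> integrable M (f i)" "\<And>i. i \<in> {1..N} \<Longrightarrow> integrable M (h i)"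
    and B: "\<And>i. i \<in> {1..N} \<Longrightarrow> expectation (\<lambda>\<omega>. \<bar>f i \<omega> - h i \<omega>\<bar>) \<le> B" and c: "0 \<le> c"
  shows "expectation (\<lambda>\<omega>. \<bar>(\<Sum>i=1..N. f i \<omega>) / c - (\<Sum>i=1..N. h i \<omega>) / c\<bar>) \<le> real N * B / c"
proof -
  have "expectation (\<lambda>\<omega>. \<bar>(\<Sum>i=1..N. f i \<omega>) / c - (\<Sum>i=1..N. h i \<omega>) / c\<bar>)
    \<le> expectation (\<lambda>\<omega>. (\<Sum>i=1..N. \<bar>f i \<omega> - h i \<omega>\<bar>) / c)"
  proof (rule integral_mono)
    show "integrable M (\<lambda>\<omega>. \<bar>(\<Sum>i=1..N. f i \<omega>) / c - (\<Sum>i=1..N. h i \<omega>) / c\<bar>)"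
      "integrable M (\<lambda>\<omega>. (\<Sum>i=1..N. \<bar>f i \<omega> - h i \<omega>\<bar>) / c)"
      by (intro integrable_abs Bochner_Integration.integrable_diff integrable_divide Bochner_Integration.integrable_sum int; assumption)+
    show "\<bar>(\<Sum>i=1..N. f i \<omega>) / c - (\<Sum>i=1..N. h i \<omega>) / c\<bar> \<le> (\<Sum>i=1..N. \<bar>f i \<omega> - h i \<omega>\<bar>) / c" for \<omega>
      using c sum_abs[of "\<lambda>i. f i \<omega> - h i \<omega>" "{1..N}"]
      by (simp add: diff_divide_distrib[symmetric] sum_subtractf[symmetric] divide_right_mono)
  qed
  also have "\<dots> = (\<Sum>i=1..N. expectation (\<lambda>\<omega>. \<bar>f i \<omega> - h i \<omega>\<bar>)) / c"
    using int by (simp add: Bochner_Integration.integral_sum del: One_nat_def)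
  also have "\<dots> \<le> real N * B / c"
    using sum_bounded_above[of "{1..N}" "\<lambda>i. expectation (\<lambda>\<omega>. \<bar>f i \<omega> - h i \<omega>\<bar>)" B] B c
    by (intro divide_right_mono) auto
  finally show ?thesis .
qed

section \<open>Tails of Pareto type\<close>

text \<open>Extracts the two facts about the density that the rest relies on: a tail with explicit
  error, for the moments, and a local bound on the mass of short intervals near 1, for the
  perturbations. The second follows from the mean value theorem, since for \<beta> > 1 the density
  at distance at most \<open>s\<close> from 1 is at most a multiple of
  \<open>s powr (\<beta> - 1)\<close>.\<close>

lemma (in real_distribution) tail_of_regular_density:
  fixes g :: "real \<Rightarrow> real"
  assumes below_1: "AE x in M. x < 1"
    and deriv: "\<forall>\<^sub>F x in at_left 1. (cdf M has_real_derivative g x) (at x)"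
    and h: "h \<in> O[at_left 1](\<lambda>x. (1 - x) powr \<nu>)"
    and g: "\<forall>\<^sub>F x in at_left 1. g x = \<kappa> * \<beta> * (1 - x) powr (\<beta> - 1) * (1 + h x)"
    and \<beta>: "\<beta> > 1" and \<nu>: "\<nu> > 0" and \<kappa>: "\<kappa> > 0"
  obtains C s0 where "0 < C" "0 < s0" "s0 \<le> 1"
    "\<And>s. 0 < s \<Longrightarrow> s < s0 \<Longrightarrow> \<bar>prob {1 - s<..} - \<kappa> * s powr \<beta>\<bar> \<le> C * s powr (\<beta> + \<nu>)"
    "\<And>s u v. 0 < s \<Longrightarrow> s < s0 \<Longrightarrow> 1 - s \<le> u \<Longrightarrow> u \<le> v \<Longrightarrow> prob {u<..v} \<le> C * (v - u) * s powr (\<beta> - 1)"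
proof -
  obtain c where c: "0 < c" "\<forall>\<^sub>F x in at_left 1. norm (h x) \<le> c * norm ((1 - x) powr \<nu>)"
    using landau_o.bigE[OF h] by blast
  have "\<forall>\<^sub>F x in at_left 1. (cdf M has_real_derivative g x) (at x) \<and>
      g x = \<kappa> * \<beta> * (1 - x) powr (\<beta> - 1) * (1 + h x) \<and> \<bar>h x\<bar> \<le> c * (1 - x) powr \<nu>"
    using deriv g c(2) by eventually_elim auto
  then obtain b where b: "b < 1" and bP: "\<And>x. b < x \<Longrightarrow> x < 1 \<Longrightarrow> (cdf M has_real_derivative g x) (at x) \<and>
      g x = \<kappa> * \<beta> * (1 - x) powr (\<beta> - 1) * (1 + h x) \<and> \<bar>h x\<bar> \<le> c * (1 - x) powr \<nu>"
    unfolding eventually_at_left_field by blast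
  \<comment> \<open>The cap 1 lets \<open>(1 - x) powr \<nu>\<close> be bounded by 1, so that the
    factor \<open>1 + h x\<close> is at most \<open>1 + c\<close>; this gives
    \<open>C2\<close>.\<close>
  define s0 where "s0 = min 1 (1 - b)"
  have s0: "0 < s0" "s0 \<le> 1" using b by (auto simp: s0_def)
  have inb: "b < x" if "1 - s0 < x" for x using that by (auto simp: s0_def min_def split: if_splits)
  define C2 where "C2 = \<kappa> * \<beta> * (1 + c)"
  \<comment> \<open>The constant that appears when the error
    \<open>\<kappa> * \<beta> * c * (1 - x) powr (\<beta> + \<nu> - 1)\<close> of the density is
    integrated up to 1.\<close>
  define C1 where "C1 = \<kappa> * \<beta> * c / (\<beta> + \<nu>)"
  define C where "C = max C1 C2"
  have kb: "0 < \<kappa> * \<beta>" using \<kappa> \<beta> by simp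
  have C2: "0 < C2" unfolding C2_def using mult_pos_pos[OF kb, of "1 + c"] c by simp
  have C: "0 < C" "C1 \<le> C" "C2 \<le> C" using C2 by (auto simp: C_def)
  have one: "measure M {..<1} = 1"
    using below_1 by (intro prob_eq_1[THEN iffD2]) auto
  have G1: "(cdf M \<longlongrightarrow> 1) (at_left 1)"
    using cdf_at_left[of 1] by (simp add: one)

  have g_diff: "\<bar>g x - \<kappa> * \<beta> * (1 - x) powr (\<beta> - 1)\<bar> \<le> \<kappa> * \<beta> * c * (1 - x) powr (\<beta> + \<nu> - 1)"
    if x: "1 - s0 < x" "x < 1" for x
  proof -
    have "g x - \<kappa> * \<beta> * (1 - x) powr (\<beta> - 1) = \<kappa> * \<beta> * (1 - x) powr (\<beta> - 1) * h x"
      using bP[OF inb[OF x(1)] x(2)] by (simp add: algebra_simps)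
    then have "\<bar>g x - \<kappa> * \<beta> * (1 - x) powr (\<beta> - 1)\<bar> = \<kappa> * \<beta> * (1 - x) powr (\<beta> - 1) * \<bar>h x\<bar>"
      using \<kappa> \<beta> by (simp add: abs_mult)
    also have "\<dots> \<le> \<kappa> * \<beta> * (1 - x) powr (\<beta> - 1) * (c * (1 - x) powr \<nu>)"
      using bP[OF inb[OF x(1)] x(2)] kb by (intro mult_left_mono) auto
    also have "\<dots> = \<kappa> * \<beta> * c * ((1 - x) powr (\<beta> - 1) * (1 - x) powr \<nu>)" by simp
    also have "(1 - x) powr (\<beta> - 1) * (1 - x) powr \<nu> = (1 - x) powr (\<beta> + \<nu> - 1)"
      using x by (simp add: powr_add[symmetric] algebra_simps)
    finally show ?thesis .
  qed
  have g_le: "g x \<le> C2 * s powr (\<beta> - 1)" if x: "1 - s \<le> x" "x < 1" "0 < s" "s < s0" for x s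
  proof -
    have x': "1 - s0 < x" using x by linarith
    have "h x \<le> c * (1 - x) powr \<nu>" using bP[OF inb[OF x'] x(2)] by auto
    also have "\<dots> \<le> c * 1"
      using c x s0 \<nu> by (intro mult_left_mono powr_le1) auto
    finally have "g x \<le> \<kappa> * \<beta> * (1 - x) powr (\<beta> - 1) * (1 + c)"
      using bP[OF inb[OF x'] x(2)] kb by (auto intro!: mult_left_mono)
    also have "\<dots> \<le> \<kappa> * \<beta> * s powr (\<beta> - 1) * (1 + c)"
      using kb c x \<beta> by (intro mult_right_mono mult_left_mono powr_mono2) auto
    finally show ?thesis by (simp add: C2_def algebra_simps)
  qed
  have G_lip: "cdf M v - cdf M u \<le> C2 * (v - u) * s powr (\<beta> - 1)"
    if uv: "1 - s \<le> u" "u \<le> v" "v < 1" "0 < s" "s < s0" for u v s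
  proof (cases "u = v")
    case False
    with uv have "u < v" by simp
    then obtain z where z: "u < z" "z < v" "cdf M v - cdf M u = (v - u) * g z"
      using MVT2[of u v "cdf M" g] bP inb uv by (smt (verit))
    then have "cdf M v - cdf M u \<le> (v - u) * (C2 * s powr (\<beta> - 1))"
      using uv by (auto intro!: mult_left_mono g_le)
    then show ?thesis by (simp add: algebra_simps)
  qed simp
  have T2: "prob {u<..v} \<le> C * (v - u) * s powr (\<beta> - 1)"
    if uv: "0 < s" "s < s0" "1 - s \<le> u" "u \<le> v" for s u v
  proof -
    have eq: "prob {u<..v} = cdf M v - cdf M u" using uv
      by (cases "u = v") (auto simp: cdf_diff_eq)
    have "prob {u<..v} \<le> C2 * (v - u) * s powr (\<beta> - 1)"
    proof (cases "v < 1")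
      case True
      then show ?thesis unfolding eq using G_lip uv by auto
    next
      case False
      show ?thesis
      proof (cases "u < 1")
        case True
        \<comment> \<open>The derivative is known only to the left of 1, so an interval reaching 1
          is handled by a limit; the left limit of the distribution function there is already 1, so
          no mass is missed.\<close>
        have "1 - cdf M u \<le> C2 * (1 - u) * s powr (\<beta> - 1)"
        proof (rule tendsto_upperbound)
          show "((\<lambda>y. cdf M y - cdf M u) \<longlongrightarrow> 1 - cdf M u) (at_left 1)"
            by (intro tendsto_intros G1)
          have "\<forall>\<^sub>F y in at_left 1. u < y \<and> y < 1"
            using True by (auto simp: eventually_at_left_field)
          then show "\<forall>\<^sub>F y in at_left 1. cdf M y - cdf M u \<le> C2 * (1 - u) * s powr (\<beta> - 1)"
          proof eventually_elim
            case (elim y)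
            have "cdf M y - cdf M u \<le> C2 * (y - u) * s powr (\<beta> - 1)"
              using elim uv by (intro G_lip) auto
            also have "\<dots> \<le> C2 * (1 - u) * s powr (\<beta> - 1)"
              using C2 elim by (intro mult_right_mono mult_left_mono) auto
            finally show ?case .
          qed
        qed simp
        moreover have "cdf M v \<le> 1" by (rule cdf_bounded_prob)
        moreover have "C2 * (1 - u) * s powr (\<beta> - 1) \<le> C2 * (v - u) * s powr (\<beta> - 1)"
          using C2 False by (intro mult_right_mono mult_left_mono) auto
        ultimately show ?thesis unfolding eq by linarith
      next
        case False
        have "prob {u<..v} \<le> prob (space M - {..<1})"
          using False by (intro finite_measure_mono) auto
        also have "\<dots> = 0" by (subst prob_compl) (auto simp: one)
        also have "0 \<le> C2 * (v - u) * s powr (\<beta> - 1)"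
          using C2 uv by auto
        finally show ?thesis .
      qed
    qed
    also have "\<dots> \<le> C * (v - u) * s powr (\<beta> - 1)"
      using C uv by (intro mult_right_mono) auto
    finally show ?thesis .
  qed

  text \<open>\<open>K + q\<close> decreases and \<open>K - q\<close> increases to the common limit 1 at the end point, so that
    \<open>\<bar>K - 1\<bar> \<le> q\<close>; no integration of the density is needed.\<close>
  define q where "q x = C1 * (1 - x) powr (\<beta> + \<nu>)" for x :: real
  define K where "K x = cdf M x + \<kappa> * (1 - x) powr \<beta>" for x
  have dpow: "((\<lambda>x::real. (1 - x) powr e) has_real_derivative (- e * (1 - x) powr (e - 1))) (at x)" if "x < 1" for x e
    using that by (auto intro!: derivative_eq_intros simp: powr_diff)
  have dq: "(q has_real_derivative (- (\<kappa> * \<beta> * c) * (1 - x) powr (\<beta> + \<nu> - 1))) (at x)" if "x < 1" for x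
  proof -
    have "(q has_real_derivative (C1 * (- (\<beta> + \<nu>) * (1 - x) powr (\<beta> + \<nu> - 1)))) (at x)"
      unfolding q_def by (intro DERIV_cmult dpow that)
    moreover have "C1 * (- (\<beta> + \<nu>)) = - (\<kappa> * \<beta> * c)"
      unfolding mult_minus_right C1_def using \<beta> \<nu> by simp
    ultimately show ?thesis by (simp add: mult.assoc[symmetric])
  qed
  have dK: "(K has_real_derivative (g x - \<kappa> * \<beta> * (1 - x) powr (\<beta> - 1))) (at x)" if x: "1 - s0 < x" "x < 1" for x
  proof -
    have "(K has_real_derivative (g x + \<kappa> * (- \<beta> * (1 - x) powr (\<beta> - 1)))) (at x)"
      unfolding K_def using bP[OF inb[OF x(1)] x(2)] by (intro DERIV_add DERIV_cmult dpow x) auto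
    then show ?thesis by (simp add: algebra_simps)
  qed
  have pow0: "((\<lambda>x::real. (1 - x) powr e) \<longlongrightarrow> 0) (at_left 1)" if "0 < e" for e
    using that by real_asymp
  have q0: "(q \<longlongrightarrow> 0) (at_left 1)"
    unfolding q_def using tendsto_mult_right_zero[OF pow0[of "\<beta> + \<nu>"], of C1] \<beta> \<nu> by simp
  have K1: "(K \<longlongrightarrow> 1) (at_left 1)"
    unfolding K_def using tendsto_add[OF G1 tendsto_mult_right_zero[OF pow0[of \<beta>], of \<kappa>]] \<beta> by simp
  have near: "\<forall>\<^sub>F y in at_left 1. x < y \<and> y < 1" if "x < 1" for x :: real
    using that by (auto simp: eventually_at_left_field)
  have T1: "\<bar>prob {1 - s<..} - \<kappa> * s powr \<beta>\<bar> \<le> C * s powr (\<beta> + \<nu>)" if s: "0 < s" "s < s0" for s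
  proof -
    define x where "x = 1 - s"
    have x: "1 - s0 < x" "x < 1" using s by (auto simp: x_def)
    have "1 \<le> K x + q x"
    proof (rule tendsto_upperbound)
      show "((\<lambda>y. K y + q y) \<longlongrightarrow> 1) (at_left 1)" using tendsto_add[OF K1 q0] by simp
      show "\<forall>\<^sub>F y in at_left 1. K y + q y \<le> K x + q x"
        using near[OF x(2)]
      proof eventually_elim
        case (elim y)
        show ?case
        proof (rule DERIV_nonpos_imp_nonincreasing[where f="\<lambda>y. K y + q y"])
          fix z assume z: "x \<le> z" "z \<le> y"
          then have z': "1 - s0 < z" "z < 1" using elim x by auto
          show "\<exists>w. DERIV (\<lambda>y. K y + q y) z :> w \<and> w \<le> 0"
            using DERIV_add[OF dK[OF z'] dq[OF z'(2)]] g_diff[OF z'] by (intro exI conjI) (assumption, auto)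
        qed (use elim in auto)
      qed
    qed simp
    moreover have "K x - q x \<le> 1"
    proof (rule tendsto_lowerbound)
      show "((\<lambda>y. K y - q y) \<longlongrightarrow> 1) (at_left 1)" using tendsto_diff[OF K1 q0] by simp
      show "\<forall>\<^sub>F y in at_left 1. K x - q x \<le> K y - q y"
        using near[OF x(2)]
      proof eventually_elim
        case (elim y)
        show ?case
        proof (rule DERIV_nonneg_imp_nondecreasing[where f="\<lambda>y. K y - q y"])
          fix z assume z: "x \<le> z" "z \<le> y"
          then have z': "1 - s0 < z" "z < 1" using elim x by auto
          show "\<exists>w. DERIV (\<lambda>y. K y - q y) z :> w \<and> 0 \<le> w"
            using DERIV_diff[OF dK[OF z'] dq[OF z'(2)]] g_diff[OF z'] by (intro exI conjI) (assumption, auto)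
        qed (use elim in auto)
      qed
    qed simp
    moreover have "prob {1 - s<..} = 1 - cdf M x"
    proof -
      have "prob (space M - {..x}) = 1 - cdf M x" unfolding cdf_def by (rule prob_compl) auto
      moreover have "space M - {..x} = {1 - s<..}" by (auto simp: x_def)
      ultimately show ?thesis by simp
    qed
    ultimately have "\<bar>prob {1 - s<..} - \<kappa> * s powr \<beta>\<bar> \<le> C1 * s powr (\<beta> + \<nu>)"
      unfolding K_def q_def x_def by (simp add: abs_le_iff)
    also have "\<dots> \<le> C * s powr (\<beta> + \<nu>)" using C by (intro mult_right_mono) auto
    finally show ?thesis .
  qed
  show ?thesis by (rule that[OF C(1) s0 T1 T2])
qed

section \<open>The truncated log excess and its level sets\<close>

definition exceed :: "real \<Rightarrow> real \<Rightarrow> real \<Rightarrow> real" where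
  "exceed d r x = (if tilde_a d r x > 1 - d then 1 else 0)"

definition log_excess :: "real \<Rightarrow> real \<Rightarrow> real \<Rightarrow> real" where
  "log_excess d r x = (if tilde_a d r x > 1 - d then ln (d / (1 - tilde_a d r x)) else 0)"

lemma beta_est_eq: "beta_est N d r x = (\<Sum>i=1..N. exceed d r (x i)) / (\<Sum>i=1..N. log_excess d r (x i))"
  by (simp add: beta_est_def exceed_def log_excess_def)

lemma exceed_measurable[measurable]: "exceed d r \<in> borel_measurable borel"
  unfolding exceed_def[abs_def] tilde_a_def by measurable

lemma log_excess_measurable[measurable]: "log_excess d r \<in> borel_measurable borel"
  unfolding log_excess_def[abs_def] tilde_a_def by measurable

context
  fixes d r :: real
  assumes d: "0 < d" "d < 1" and r: "1 < r"
begin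

lemma trunc_powr_less: "0 < d powr r" "d powr r < d"
  using d r powr_less_mono'[of d 1 r] by auto

text \<open>Below the cutoff \<open>(r - 1) * ln (1 / d)\<close> the truncation is invisible:
  \<open>t\<close> lies below it exactly when \<open>d * exp (- t)\<close> exceeds
  \<open>d powr r\<close>, so the level set is the half line that the untruncated excess would
  have.\<close>

lemma log_excess_gt_iff:
  assumes t: "0 \<le> t" "t < (r - 1) * ln (1 / d)"
  shows "log_excess d r x > t \<longleftrightarrow> x > 1 - d * exp (- t)"
proof -
  have de: "d powr r < d * exp (- t)"
  proof -
    have "d powr r = exp (ln d + - ((r - 1) * ln (1 / d)))"
      using d by (simp add: powr_def ln_div algebra_simps)
    also have "\<dots> = d * exp (- ((r - 1) * ln (1 / d)))" using d by (subst exp_add) simp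
    also have "\<dots> < d * exp (- t)" using d t by simp
    finally show ?thesis .
  qed
  have le: "d * exp (- t) \<le> d" using d t by simp
  let ?y = "tilde_a d r x"
  have y: "1 - ?y > 0" unfolding tilde_a_def using trunc_powr_less(1) by linarith
  have gt: "?y > 1 - d * exp (- t) \<longleftrightarrow> x > 1 - d * exp (- t)"
    unfolding tilde_a_def using de by auto
  show ?thesis
  proof (cases "?y > 1 - d")
    case True
    have "t < ln (d / (1 - ?y)) \<longleftrightarrow> exp t < d / (1 - ?y)"
      using d y by (subst exp_less_cancel_iff[symmetric]) simp
    also have "\<dots> \<longleftrightarrow> exp t * (1 - ?y) < d" using y by (simp add: less_divide_eq)
    also have "\<dots> \<longleftrightarrow> 1 - ?y < d * exp (- t)"
      by (simp add: exp_minus field_simps)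
    finally show ?thesis using True gt by (auto simp: log_excess_def)
  next
    case False
    then show ?thesis using gt le t by (auto simp: log_excess_def)
  qed
qed

lemma log_excess_nonneg: "0 \<le> log_excess d r x"
proof (cases "tilde_a d r x > 1 - d")
  case True
  have "1 - tilde_a d r x > 0" unfolding tilde_a_def using trunc_powr_less(1) by linarith
  then show ?thesis using True d by (simp add: log_excess_def)
qed (simp add: log_excess_def)

lemma log_excess_le: "log_excess d r x \<le> (r - 1) * ln (1 / d)"
proof (cases "tilde_a d r x > 1 - d")
  case True
  have y: "1 - tilde_a d r x \<ge> d powr r" unfolding tilde_a_def by auto
  then have "d / (1 - tilde_a d r x) \<le> d / d powr r"
    using d trunc_powr_less(1) order_less_le_trans[OF trunc_powr_less(1) y]
    by (intro divide_left_mono mult_pos_pos) linarith+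
  moreover have "0 < d / (1 - tilde_a d r x)"
    using d order_less_le_trans[OF trunc_powr_less(1) y] by (intro divide_pos_pos) linarith+
  ultimately have "ln (d / (1 - tilde_a d r x)) \<le> ln (d / d powr r)"
    by (intro ln_mono) auto
  also have "\<dots> = (r - 1) * ln (1 / d)"
    using d by (simp add: ln_div ln_powr algebra_simps)
  finally show ?thesis using True by (simp add: log_excess_def)
qed (use d r in \<open>simp add: log_excess_def\<close>)

text \<open>Level sets are upward closed. If monotonicity failed, the value at \<open>y\<close>
  would lie strictly below the value at \<open>x\<close>, hence below the cutoff, and would be an
  admissible level that \<open>x\<close> passes but the larger \<open>y\<close> does not.\<close>

lemma log_excess_mono: "x \<le> y \<Longrightarrow> log_excess d r x \<le> log_excess d r y"
proof (rule ccontr)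
  assume xy: "x \<le> y" "\<not> log_excess d r x \<le> log_excess d r y"
  then show False
    using log_excess_gt_iff[OF log_excess_nonneg, of y x] log_excess_gt_iff[OF log_excess_nonneg, of y y]
      log_excess_le[of x] by auto
qed

text \<open>This form links the indicator to the log excess in moment computations; the form
  \<open>exceed_iff\<close> serves the perturbation bound.\<close>

lemma exceed_eq: "exceed d r x = of_bool (log_excess d r x > 0)"
proof -
  have "0 < (r - 1) * ln (1 / d)" using d r by simp
  then have "log_excess d r x > 0 \<longleftrightarrow> x > 1 - d" using log_excess_gt_iff[of 0 x] by simp
  also have "x > 1 - d \<longleftrightarrow> tilde_a d r x > 1 - d" using trunc_powr_less unfolding tilde_a_def by auto
  finally show ?thesis by (simp add: exceed_def)
qed

lemma exceed_iff: "exceed d r x = of_bool (x > 1 - d)"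
  using trunc_powr_less unfolding exceed_def tilde_a_def by auto

end

text \<open>Covers thresholds \<open>d\<close> not below 1 as well, since \<delta> is small only
  eventually while integrability is wanted for every sample size. For \<open>d \<ge> 1\<close> one
  has \<open>d \<le> d powr r\<close>, so nothing exceeds the threshold.\<close>

lemma log_excess_bounded:
  assumes "0 < d" "1 < r"
  shows "0 \<le> log_excess d r x" "log_excess d r x \<le> (r - 1) * \<bar>ln d\<bar>"
proof -
  have "0 \<le> log_excess d r x \<and> log_excess d r x \<le> (r - 1) * \<bar>ln d\<bar>"
  proof (cases "d < 1")
    case True
    then have "ln (1 / d) = \<bar>ln d\<bar>" using assms by (simp add: ln_div)
    with True show ?thesis using log_excess_nonneg[of d r x] log_excess_le[of d r x] assms by simp
  next
    case False
    then have "d \<le> d powr r" using powr_mono[of 1 r d] assms by simp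
    then have "\<not> tilde_a d r x > 1 - d" unfolding tilde_a_def by auto
    then show ?thesis using assms by (simp add: log_excess_def)
  qed
  then show "0 \<le> log_excess d r x" "log_excess d r x \<le> (r - 1) * \<bar>ln d\<bar>" by auto
qed

text \<open>Given an exceedance, the log excess is nearly exponential with rate \<open>\<beta>\<close>, so the score is
  nearly centred.\<close>

definition score :: "real \<Rightarrow> real \<Rightarrow> real \<Rightarrow> real \<Rightarrow> real" where
  "score \<beta> d r x = exceed d r x - \<beta> * log_excess d r x"

lemma score_measurable[measurable]: "score \<beta> d r \<in> borel_measurable borel"
  unfolding score_def[abs_def] by measurable

lemma exceed_range: "0 \<le> exceed d r x" "exceed d r x \<le> 1"
  by (auto simp: exceed_def)

lemma score_bounded:
  assumes "0 < d" "1 < r" "0 \<le> \<beta>"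
  shows "\<bar>score \<beta> d r x\<bar> \<le> 1 + \<beta> * ((r - 1) * \<bar>ln d\<bar>)"
proof -
  have "\<beta> * log_excess d r x \<le> \<beta> * ((r - 1) * \<bar>ln d\<bar>)"
    using log_excess_bounded[OF assms(1,2)] assms(3) by (intro mult_left_mono)
  moreover have "0 \<le> \<beta> * log_excess d r x" using log_excess_bounded[OF assms(1,2)] assms(3) by simp
  moreover have "0 \<le> exceed d r x" "exceed d r x \<le> 1" by (rule exceed_range)+
  ultimately show ?thesis unfolding score_def by linarith
qed

section \<open>Moments of the log excess and the score under a Pareto tail\<close>

locale pareto_tail = real_distribution \<mu> for \<mu> :: "real measure" +
  fixes \<beta> \<nu> \<kappa> C s0 r :: real
  assumes \<beta>: "1 < \<beta>" and \<nu>: "0 < \<nu>" and \<kappa>: "0 < \<kappa>" and r: "1 < r"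
    and C: "0 < C" and s0: "0 < s0" "s0 \<le> 1"
    and tail: "0 < s \<Longrightarrow> s < s0 \<Longrightarrow> \<bar>prob {1 - s<..} - \<kappa> * s powr \<beta>\<bar> \<le> C * s powr (\<beta> + \<nu>)"
    and local_mass: "0 < s \<Longrightarrow> s < s0 \<Longrightarrow> 1 - s \<le> u \<Longrightarrow> u \<le> v \<Longrightarrow>
      prob {u<..v} \<le> C * (v - u) * s powr (\<beta> - 1)"
begin

lemma integrable_exceed: "integrable \<mu> (exceed d r)"
  by (rule integrable_const_bound[where B=1]) (auto simp: exceed_def)

lemma integrable_log_excess_power:
  assumes "0 < d" shows "integrable \<mu> (\<lambda>x. log_excess d r x ^ k)"
  using log_excess_bounded[OF assms r]
  by (intro integrable_const_bound[where B="((r - 1) * \<bar>ln d\<bar>) ^ k"] AE_I2) (auto intro!: power_mono)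

lemma integrable_log_excess: "0 < d \<Longrightarrow> integrable \<mu> (log_excess d r)"
  using integrable_log_excess_power[of d 1] by simp

text \<open>Substituting \<open>s = d * exp (- t)\<close> turns the power tail into an exponential
  one with rate \<beta>. The relative error is \<open>C * d powr \<nu> * exp (- \<nu> * t)\<close>;
  dropping the last factor makes it uniform in \<open>t\<close>.\<close>

lemma tail_log_excess:
  assumes d: "0 < d" "d < s0" and t: "0 \<le> t" "t < (r - 1) * ln (1 / d)"
  shows "(\<kappa> - C * d powr \<nu>) * d powr \<beta> * exp (- \<beta> * t) \<le> prob {x\<in>space \<mu>. log_excess d r x > t} \<and>
    prob {x\<in>space \<mu>. log_excess d r x > t} \<le> (\<kappa> + C * d powr \<nu>) * d powr \<beta> * exp (- \<beta> * t)"
proof -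
  have d1: "d < 1" using d s0 by simp
  define s where "s = d * exp (- t)"
  have s: "0 < s" "s < s0"
    using d t by (auto simp: s_def intro: le_less_trans[OF mult_left_le])
  have set_eq: "{x\<in>space \<mu>. log_excess d r x > t} = {1 - s<..}"
    using log_excess_gt_iff[OF d(1) d1 r t] by (auto simp: s_def)
  have pow: "s powr c = d powr c * exp (- c * t)" for c
    unfolding s_def using d by (subst powr_mult) (auto simp: exp_powr_real mult.commute)
  have "C * s powr (\<beta> + \<nu>) = C * d powr \<nu> * d powr \<beta> * exp (- \<beta> * t) * exp (- \<nu> * t)"
    unfolding pow by (simp add: powr_add exp_add[symmetric] algebra_simps)
  also have "\<dots> \<le> C * d powr \<nu> * d powr \<beta> * exp (- \<beta> * t) * 1"
    using C \<nu> t by (intro mult_left_mono) auto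
  finally show ?thesis using tail[OF s] unfolding set_eq pow by (simp add: abs_le_iff algebra_simps)
qed

text \<open>The condition \<open>C * d powr \<nu> \<le> \<kappa>\<close> makes the constant of the
  lower tail bound nonnegative, as the layer cake estimate requires, and caps that of the upper
  bound by \<open>2 * \<kappa>\<close>.\<close>

context
  fixes d :: real
  assumes d: "0 < d" "d < s0" and Cd: "C * d powr \<nu> \<le> \<kappa>"
begin

lemma d_less_1: "d < 1" using d s0 by simp

text \<open>The fraction of an exponential law of rate \<beta> that lies beyond the cutoff; it is
  the origin of the exponent \<open>(r - 1) * \<beta>\<close> in the bias.\<close>

lemma exp_cutoff: "exp (- \<beta> * ((r - 1) * ln (1 / d))) = d powr ((r - 1) * \<beta>)"
  using d by (simp add: powr_def ln_div algebra_simps)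

lemma expectation_exceed_bounds:
  "(\<kappa> - C * d powr \<nu>) * d powr \<beta> \<le> expectation (exceed d r)"
  "expectation (exceed d r) \<le> (\<kappa> + C * d powr \<nu>) * d powr \<beta>"
proof -
  have "expectation (exceed d r) = expectation (indicator {x\<in>space \<mu>. log_excess d r x > 0})"
    using exceed_eq[OF d(1) d_less_1 r] by (intro Bochner_Integration.integral_cong) (auto simp: indicator_def)
  also have "\<dots> = prob {x\<in>space \<mu>. log_excess d r x > 0}" by simp
  finally show "(\<kappa> - C * d powr \<nu>) * d powr \<beta> \<le> expectation (exceed d r)"
    "expectation (exceed d r) \<le> (\<kappa> + C * d powr \<nu>) * d powr \<beta>"
    using tail_log_excess[OF d, of 0] r d d_less_1 by simp_all
qed

text \<open>For \<open>F t = t ^ k\<close> the difference of \<open>H\<close> at the cutoff and at 0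
  is the k-th moment of an exponential variable of rate \<beta> capped at the cutoff. The three
  applications therefore have main terms 1/\<beta>, 2/\<beta>^2 and 6/\<beta>^3, with
  \<open>H\<close> found by partial integration.\<close>

lemma expectation_power_bounds:
  fixes f F H :: "real \<Rightarrow> real"
  assumes F: "\<And>t. DERIV F t :> f t" and F0: "F 0 = 0"
    and f_nonneg: "\<And>t. 0 \<le> t \<Longrightarrow> 0 \<le> f t" and f: "f \<in> borel_measurable borel"
    and H: "\<And>t. DERIV H t :> f t * exp (- \<beta> * t)"
    and int: "integrable \<mu> (\<lambda>x. F (log_excess d r x))"
  shows "(\<kappa> - C * d powr \<nu>) * d powr \<beta> * (H ((r - 1) * ln (1 / d)) - H 0) \<le> expectation (\<lambda>x. F (log_excess d r x))"
    and "expectation (\<lambda>x. F (log_excess d r x)) \<le> (\<kappa> + C * d powr \<nu>) * d powr \<beta> * (H ((r - 1) * ln (1 / d)) - H 0)"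
proof -
  let ?Y = "log_excess d r" and ?L = "(r - 1) * ln (1 / d)"
  have L: "0 \<le> ?L" using d d_less_1 r by simp
  have Y: "\<And>x. x \<in> space \<mu> \<Longrightarrow> 0 \<le> ?Y x \<and> ?Y x \<le> ?L"
    using log_excess_nonneg[OF d(1) d_less_1 r] log_excess_le[OF d(1) d_less_1 r] by auto
  have lo: "0 \<le> (\<kappa> - C * d powr \<nu>) * d powr \<beta>" "0 \<le> (\<kappa> + C * d powr \<nu>) * d powr \<beta>"
    using Cd C \<kappa> by auto
  have meas: "?Y \<in> borel_measurable \<mu>" by simp
  note * = expectation_exp_tail_bounds[where Y="?Y" and F=F and H=H and L="?L" and b=\<beta>,
      OF meas Y L F F0 f_nonneg f H tail_log_excess[OF d] lo int]
  show "(\<kappa> - C * d powr \<nu>) * d powr \<beta> * (H ?L - H 0) \<le> expectation (\<lambda>x. F (?Y x))"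
    by (rule *(1))
  show "expectation (\<lambda>x. F (?Y x)) \<le> (\<kappa> + C * d powr \<nu>) * d powr \<beta> * (H ?L - H 0)"
    by (rule *(2))
qed

lemma expectation_log_excess_bounds:
  "(\<kappa> - C * d powr \<nu>) * d powr \<beta> * ((1 - d powr ((r - 1) * \<beta>)) / \<beta>) \<le> expectation (log_excess d r)"
  "expectation (log_excess d r) \<le> (\<kappa> + C * d powr \<nu>) * d powr \<beta> * ((1 - d powr ((r - 1) * \<beta>)) / \<beta>)"
proof -
  let ?H = "\<lambda>t. - exp (- \<beta> * t) / \<beta>"
  have H: "DERIV ?H t :> 1 * exp (- \<beta> * t)" for t
    using \<beta> by (auto intro!: derivative_eq_intros)
  have eq: "?H ((r - 1) * ln (1 / d)) - ?H 0 = (1 - d powr ((r - 1) * \<beta>)) / \<beta>"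
    unfolding exp_cutoff using \<beta> by (simp add: field_simps)
  note * = expectation_power_bounds[of "\<lambda>t. t" "\<lambda>_. 1" ?H, OF _ _ _ _ H, unfolded eq]
  show "(\<kappa> - C * d powr \<nu>) * d powr \<beta> * ((1 - d powr ((r - 1) * \<beta>)) / \<beta>) \<le> expectation (log_excess d r)"
    by (rule *(1)) (auto intro: integrable_log_excess d)
  show "expectation (log_excess d r) \<le> (\<kappa> + C * d powr \<nu>) * d powr \<beta> * ((1 - d powr ((r - 1) * \<beta>)) / \<beta>)"
    by (rule *(2)) (auto intro: integrable_log_excess d)
qed

lemma expectation_log_excess_square_bounds:
  defines "J \<equiv> 2 / \<beta>\<^sup>2 - (2 * ((r - 1) * ln (1 / d)) / \<beta> + 2 / \<beta>\<^sup>2) * d powr ((r - 1) * \<beta>)"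
  shows "(\<kappa> - C * d powr \<nu>) * d powr \<beta> * J \<le> expectation (\<lambda>x. (log_excess d r x)\<^sup>2)"
  "expectation (\<lambda>x. (log_excess d r x)\<^sup>2) \<le> (\<kappa> + C * d powr \<nu>) * d powr \<beta> * J"
proof -
  let ?H = "\<lambda>t. - ((2 * t / \<beta> + 2 / \<beta>\<^sup>2) * exp (- \<beta> * t))"
  have H: "DERIV ?H t :> (2 * t) * exp (- \<beta> * t)" for t
    using \<beta> by (auto intro!: derivative_eq_intros simp: field_simps power2_eq_square)
  have eq: "?H ((r - 1) * ln (1 / d)) - ?H 0 = J"
    unfolding exp_cutoff J_def by simp
  have F: "DERIV (\<lambda>t. t\<^sup>2) t :> 2 * t" for t :: real by (auto intro!: derivative_eq_intros)
  note * = expectation_power_bounds[of "\<lambda>t. t\<^sup>2" "\<lambda>t. 2 * t" ?H, OF F _ _ _ H, unfolded eq]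
  show "(\<kappa> - C * d powr \<nu>) * d powr \<beta> * J \<le> expectation (\<lambda>x. (log_excess d r x)\<^sup>2)"
    by (rule *(1)) (auto intro: integrable_log_excess_power d)
  show "expectation (\<lambda>x. (log_excess d r x)\<^sup>2) \<le> (\<kappa> + C * d powr \<nu>) * d powr \<beta> * J"
    by (rule *(2)) (auto intro: integrable_log_excess_power d)
qed

lemma expectation_log_excess_cube_le:
  "expectation (\<lambda>x. log_excess d r x ^ 3) \<le> 2 * \<kappa> * d powr \<beta> * (6 / \<beta>^3)"
proof -
  let ?H = "\<lambda>t. - ((3 * t\<^sup>2 / \<beta> + 6 * t / \<beta>\<^sup>2 + 6 / \<beta>^3) * exp (- \<beta> * t))"
  have H: "DERIV ?H t :> (3 * t\<^sup>2) * exp (- \<beta> * t)" for t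
    using \<beta> by (auto intro!: derivative_eq_intros simp: field_simps power2_eq_square power3_eq_cube)
  have F: "DERIV (\<lambda>t. t^3) t :> 3 * t\<^sup>2" for t :: real by (auto intro!: derivative_eq_intros)
  have "0 \<le> (r - 1) * ln (1 / d)" using r d d_less_1 by simp
  then have "?H ((r - 1) * ln (1 / d)) - ?H 0 \<le> 6 / \<beta>^3" using \<beta> by simp
  moreover have "expectation (\<lambda>x. log_excess d r x ^ 3)
    \<le> (\<kappa> + C * d powr \<nu>) * d powr \<beta> * (?H ((r - 1) * ln (1 / d)) - ?H 0)"
    by (rule expectation_power_bounds(2)[of "\<lambda>t. t^3" "\<lambda>t. 3 * t\<^sup>2" ?H, OF F _ _ _ H])
      (auto intro: integrable_log_excess_power d)
  moreover have "(\<kappa> + C * d powr \<nu>) * d powr \<beta> * x \<le> 2 * \<kappa> * d powr \<beta> * (6 / \<beta>^3)" if "x \<le> 6 / \<beta>^3" for x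
  proof -
    have "(\<kappa> + C * d powr \<nu>) * d powr \<beta> * x \<le> (\<kappa> + C * d powr \<nu>) * d powr \<beta> * (6 / \<beta>^3)"
      using \<kappa> C that by (intro mult_left_mono) auto
    also have "\<dots> \<le> (\<kappa> + \<kappa>) * d powr \<beta> * (6 / \<beta>^3)"
      using Cd \<beta> by (intro mult_right_mono) auto
    finally show ?thesis by simp
  qed
  ultimately show ?thesis by (meson order_trans)
qed

text \<open>The leading term \<open>\<kappa> * d powr \<beta>\<close> of the exceedance probability
  cancels against \<beta> times the mean excess. The tail error enters once through each of the two
  means, hence \<open>2 * C\<close>; the coefficient \<kappa> belongs to the mass lost by
  truncation. As \<open>d < 1\<close>, both exponents may be lowered to the one with
  \<open>min\<close>.\<close>

lemma expectation_score_le: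
  "\<bar>expectation (score \<beta> d r)\<bar> \<le> (2 * C + \<kappa>) * d powr (\<beta> + min \<nu> ((r - 1) * \<beta>))"
proof -
  let ?D = "d powr \<beta>" and ?w = "d powr ((r - 1) * \<beta>)" and ?c = "C * d powr \<nu>"
  have mean: "expectation (score \<beta> d r) = expectation (exceed d r) - \<beta> * expectation (log_excess d r)"
    unfolding score_def[abs_def] using integrable_exceed integrable_log_excess[OF d(1)] by simp
  have b0: "0 \<le> \<beta>" using \<beta> by simp
  have "\<beta> * (z * (x / \<beta>)) = z * x" for z x using \<beta> by simp
  note l = mult_left_mono[OF expectation_log_excess_bounds(1) b0, unfolded this]
    mult_left_mono[OF expectation_log_excess_bounds(2) b0, unfolded this]
  define x y where "x = \<kappa> * ?D" and "y = ?c * ?D"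
  have nn: "0 \<le> x * ?w" "0 \<le> y * ?w" using C \<kappa> by (auto simp: x_def y_def)
  have l': "x - y - x * ?w + y * ?w \<le> \<beta> * expectation (log_excess d r)"
    "\<beta> * expectation (log_excess d r) \<le> x + y - x * ?w - y * ?w"
    using l by (simp_all add: x_def y_def algebra_simps)
  have e': "x - y \<le> expectation (exceed d r)" "expectation (exceed d r) \<le> x + y"
    using expectation_exceed_bounds by (simp_all add: x_def y_def algebra_simps)
  have "\<bar>expectation (score \<beta> d r)\<bar> \<le> 2 * y + x * ?w"
    unfolding mean abs_le_iff using l' e' nn by linarith
  also have "\<dots> = 2 * C * (?D * d powr \<nu>) + \<kappa> * (?D * ?w)" by (simp add: x_def y_def)
  also have "\<dots> \<le> 2 * C * d powr (\<beta> + min \<nu> ((r - 1) * \<beta>)) + \<kappa> * d powr (\<beta> + min \<nu> ((r - 1) * \<beta>))"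
    unfolding powr_add[symmetric] using C \<kappa> d d_less_1 by (intro add_mono mult_left_mono powr_mono') auto
  finally show ?thesis by (simp add: algebra_simps)
qed

text \<open>On an exceedance the score is 1 - y with y = \<beta> \<phi>, and its cube in absolute
  value is at most 1 + y^3. The constant is 14 = 2 + 2 * 6: twice \<kappa> for the indicator, and
  the third exponential moment 6/\<beta>^3 with the same factor.\<close>

lemma expectation_score_cube_le:
  "expectation (\<lambda>x. \<bar>score \<beta> d r x\<bar> ^ 3) \<le> 14 * \<kappa> * d powr \<beta>"
proof -
  have pw: "\<bar>score \<beta> d r x\<bar> ^ 3 \<le> exceed d r x + \<beta> ^ 3 * log_excess d r x ^ 3" for x
  proof (cases "log_excess d r x > 0")
    case True
    let ?y = "\<beta> * log_excess d r x"
    have y: "0 \<le> ?y" using True \<beta> by simp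
    have "\<bar>1 - ?y\<bar> \<le> max 1 ?y" using y by auto
    then have "\<bar>1 - ?y\<bar> ^ 3 \<le> max 1 ?y ^ 3" by (intro power_mono) auto
    also have "\<dots> \<le> 1 + ?y ^ 3" using y by (auto simp: max_def)
    finally show ?thesis using True by (simp add: score_def exceed_eq[OF d(1) d_less_1 r] power_mult_distrib)
  next
    case False
    then have "log_excess d r x = 0" using log_excess_nonneg[OF d(1) d_less_1 r, of x] by simp
    then show ?thesis by (simp add: score_def exceed_eq[OF d(1) d_less_1 r])
  qed
  have "expectation (\<lambda>x. \<bar>score \<beta> d r x\<bar> ^ 3) \<le> expectation (\<lambda>x. exceed d r x + \<beta> ^ 3 * log_excess d r x ^ 3)"
    using pw integrable_exceed integrable_log_excess_power[OF d(1), of 3]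
    by (intro integral_mono_AE' AE_I2) (auto intro: order_trans[OF _ pw])
  also have "\<dots> = expectation (exceed d r) + \<beta> ^ 3 * expectation (\<lambda>x. log_excess d r x ^ 3)"
    using integrable_exceed integrable_log_excess_power[OF d(1), of 3] by simp
  also have "\<dots> \<le> 2 * \<kappa> * d powr \<beta> + \<beta> ^ 3 * (2 * \<kappa> * d powr \<beta> * (6 / \<beta>^3))"
  proof (intro add_mono mult_left_mono expectation_log_excess_cube_le)
    have "(\<kappa> + C * d powr \<nu>) * d powr \<beta> \<le> (\<kappa> + \<kappa>) * d powr \<beta>" using Cd by (intro mult_right_mono) auto
    then show "expectation (exceed d r) \<le> 2 * \<kappa> * d powr \<beta>"
      using expectation_exceed_bounds(2) by simp
  qed (use \<beta> in auto)
  also have "\<dots> = 14 * \<kappa> * d powr \<beta>" using \<beta> by (simp add: field_simps)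
  finally show ?thesis .
qed

end

lemma eventually_small: "\<forall>\<^sub>F d in at_right 0. 0 < d \<and> d < s0 \<and> C * d powr \<nu> \<le> \<kappa>"
proof -
  have "((\<lambda>d. C * d powr \<nu>) \<longlongrightarrow> 0) (at_right 0)" using \<nu> by real_asymp
  then have "\<forall>\<^sub>F d in at_right 0. C * d powr \<nu> < \<kappa>" using \<kappa> by (rule order_tendstoD)
  moreover have "\<forall>\<^sub>F d in at_right 0. 0 < d \<and> d < s0"
    using s0 by (auto simp: eventually_at_right_field)
  ultimately show ?thesis by eventually_elim auto
qed

lemma sandwich_at_0:
  assumes J: "(J \<longlongrightarrow> j) (at_right 0)"
    and bd: "\<And>d. 0 < d \<Longrightarrow> d < s0 \<Longrightarrow> C * d powr \<nu> \<le> \<kappa> \<Longrightarrow> (\<kappa> - C * d powr \<nu>) * d powr \<beta> * J d \<le> e d \<and>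
      e d \<le> (\<kappa> + C * d powr \<nu>) * d powr \<beta> * J d"
  shows "((\<lambda>d. e d / d powr \<beta>) \<longlongrightarrow> \<kappa> * j) (at_right 0)"
proof (rule tendsto_sandwich)
  have c: "((\<lambda>d. C * d powr \<nu>) \<longlongrightarrow> 0) (at_right 0)" using \<nu> by real_asymp
  show "((\<lambda>d. (\<kappa> - C * d powr \<nu>) * J d) \<longlongrightarrow> \<kappa> * j) (at_right 0)"
    "((\<lambda>d. (\<kappa> + C * d powr \<nu>) * J d) \<longlongrightarrow> \<kappa> * j) (at_right 0)"
    by (rule tendsto_eq_intros J c refl | simp)+
  show "\<forall>\<^sub>F d in at_right 0. (\<kappa> - C * d powr \<nu>) * J d \<le> e d / d powr \<beta>"
    using eventually_small
  proof eventually_elim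
    case (elim d)
    then show ?case using bd[of d] by (simp add: le_divide_eq algebra_simps)
  qed
  show "\<forall>\<^sub>F d in at_right 0. e d / d powr \<beta> \<le> (\<kappa> + C * d powr \<nu>) * J d"
    using eventually_small
  proof eventually_elim
    case (elim d)
    then show ?case using bd[of d] by (simp add: divide_le_eq algebra_simps)
  qed
qed

lemma exceed_tendsto: "((\<lambda>d. expectation (exceed d r) / d powr \<beta>) \<longlongrightarrow> \<kappa>) (at_right 0)"
  using sandwich_at_0[of "\<lambda>_. 1" 1 "\<lambda>d. expectation (exceed d r)"] expectation_exceed_bounds by simp

lemma log_excess_tendsto: "((\<lambda>d. expectation (log_excess d r) / d powr \<beta>) \<longlongrightarrow> \<kappa> / \<beta>) (at_right 0)"
proof -
  have "0 < (r - 1) * \<beta>" using r \<beta> by simp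
  then have "((\<lambda>d. (1 - d powr ((r - 1) * \<beta>)) / \<beta>) \<longlongrightarrow> (1 - 0) / \<beta>) (at_right 0)"
    using \<beta> by (intro tendsto_intros) (real_asymp | simp)+
  from sandwich_at_0[OF this, of "\<lambda>d. expectation (log_excess d r)"] show ?thesis
    using expectation_log_excess_bounds by simp
qed

lemma log_excess_square_tendsto:
  "((\<lambda>d. expectation (\<lambda>x. (log_excess d r x)\<^sup>2) / d powr \<beta>) \<longlongrightarrow> \<kappa> * (2 / \<beta>\<^sup>2)) (at_right 0)"
proof (rule sandwich_at_0[where J="\<lambda>d. 2 / \<beta>\<^sup>2 - (2 * ((r - 1) * ln (1 / d)) / \<beta> + 2 / \<beta>\<^sup>2) * d powr ((r - 1) * \<beta>)"])
  define b where "b = (r - 1) * \<beta>"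
  have b: "0 < b" using r \<beta> by (simp add: b_def)
  have p: "((\<lambda>d. d powr b) \<longlongrightarrow> 0) (at_right 0)" using b by real_asymp
  have lp: "((\<lambda>d. ln (1 / d) * d powr b) \<longlongrightarrow> 0) (at_right 0)" using b by real_asymp
  have "((\<lambda>d. 2 / \<beta>\<^sup>2 - (2 * (r - 1) / \<beta> * (ln (1 / d) * d powr b) + 2 / \<beta>\<^sup>2 * d powr b)) \<longlongrightarrow> 2 / \<beta>\<^sup>2) (at_right 0)"
    by (rule tendsto_eq_intros p lp refl | simp)+
  then show "((\<lambda>d. 2 / \<beta>\<^sup>2 - (2 * ((r - 1) * ln (1 / d)) / \<beta> + 2 / \<beta>\<^sup>2) * d powr ((r - 1) * \<beta>)) \<longlongrightarrow> 2 / \<beta>\<^sup>2) (at_right 0)"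
    unfolding b_def[symmetric] by (simp add: algebra_simps)
qed (use expectation_log_excess_square_bounds in auto)

text \<open>The excess vanishes off the exceedance event, so \<psi> \<phi> = \<phi> and the square
  of the score is linear in \<psi>, \<phi> and \<phi>^2. The limits of the three parts are \<kappa>,
  -2 \<kappa> and 2 \<kappa>.\<close>

lemma score_square_tendsto:
  "((\<lambda>d. expectation (\<lambda>x. (score \<beta> d r x)\<^sup>2) / d powr \<beta>) \<longlongrightarrow> \<kappa>) (at_right 0)"
proof (rule Lim_transform_eventually)
  show "((\<lambda>d. expectation (exceed d r) / d powr \<beta> - 2 * \<beta> * (expectation (log_excess d r) / d powr \<beta>)
     + \<beta>\<^sup>2 * (expectation (\<lambda>x. (log_excess d r x)\<^sup>2) / d powr \<beta>)) \<longlongrightarrow> \<kappa>) (at_right 0)"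
    using tendsto_add[OF tendsto_diff[OF exceed_tendsto tendsto_mult_left[OF log_excess_tendsto, of "2 * \<beta>"]]
        tendsto_mult_left[OF log_excess_square_tendsto, of "\<beta>\<^sup>2"]] \<beta> by simp
  show "\<forall>\<^sub>F d in at_right 0. expectation (exceed d r) / d powr \<beta> - 2 * \<beta> * (expectation (log_excess d r) / d powr \<beta>)
     + \<beta>\<^sup>2 * (expectation (\<lambda>x. (log_excess d r x)\<^sup>2) / d powr \<beta>) = expectation (\<lambda>x. (score \<beta> d r x)\<^sup>2) / d powr \<beta>"
    using eventually_small
  proof eventually_elim
    case (elim d)
    then have d: "0 < d" "d < 1" using s0 by auto
    have sq: "(score \<beta> d r x)\<^sup>2 = exceed d r x - 2 * \<beta> * log_excess d r x + \<beta>\<^sup>2 * (log_excess d r x)\<^sup>2" for x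
    proof (cases "log_excess d r x > 0")
      case True
      then show ?thesis by (simp add: score_def exceed_eq[OF d r] power2_eq_square algebra_simps)
    next
      case False
      then have "log_excess d r x = 0" using log_excess_nonneg[OF d r, of x] by simp
      then show ?thesis by (simp add: score_def exceed_eq[OF d r])
    qed
    have "expectation (\<lambda>x. (score \<beta> d r x)\<^sup>2) = expectation (exceed d r) - 2 * \<beta> * expectation (log_excess d r)
      + \<beta>\<^sup>2 * expectation (\<lambda>x. (log_excess d r x)\<^sup>2)"
      unfolding sq using integrable_exceed integrable_log_excess[OF d(1)] integrable_log_excess_power[OF d(1), of 2] by simp
    then show ?case by (simp add: add_divide_distrib diff_divide_distrib)
  qed
qed

text \<open>Off the event that the perturbation exceeds \<open>e\<close>, the indicator can change
  only if \<open>X\<close> is within \<open>e\<close> of the threshold, and the log excess stays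
  between its values at \<open>X - e\<close> and \<open>X + e\<close>. The means of these two shifts
  are compared through their tails: at each level they differ by the mass of one window of width
  \<open>2 * e\<close>, bounded uniformly in the level.\<close>

lemma perturbation:
  fixes M :: "'s measure" and X \<rho> :: "'s \<Rightarrow> real"
  assumes M: "prob_space M" and X[measurable]: "X \<in> borel_measurable M" and \<rho>[measurable]: "\<rho> \<in> borel_measurable M"
    and distr: "distr M borel X = \<mu>" and d: "0 < d" "2 * d < s0" and e: "0 < e" "e \<le> d"
    and \<pi>: "measure M {\<omega>\<in>space M. \<bar>\<rho> \<omega>\<bar> > e} \<le> \<pi>"
  shows "(\<integral>\<omega>. \<bar>exceed d r (X \<omega> + \<rho> \<omega>) - exceed d r (X \<omega>)\<bar> \<partial>M) \<le> 2 * C * e * (2 * d) powr (\<beta> - 1) + \<pi>"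
    and "(\<integral>\<omega>. \<bar>log_excess d r (X \<omega> + \<rho> \<omega>) - log_excess d r (X \<omega>)\<bar> \<partial>M)
      \<le> (2 * C * e * (2 * d) powr (\<beta> - 1) + \<pi>) * ((r - 1) * ln (1 / d))"
proof -
  interpret M: prob_space M by fact
  have d1: "d < 1" using d s0 by simp
  let ?L = "(r - 1) * ln (1 / d)" and ?c = "2 * C * e * (2 * d) powr (\<beta> - 1)"
  have L: "0 \<le> ?L" using d d1 r by simp
  have c: "0 \<le> ?c" using C e by simp
  let ?B = "{\<omega>\<in>space M. \<bar>\<rho> \<omega>\<bar> > e}"
  have B[measurable]: "?B \<in> sets M" by measurable
  have iB: "integrable M (indicator ?B :: _ \<Rightarrow> real)"
    by (rule integrable_real_indicator) (auto simp: M.emeasure_eq_measure)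
  \<comment> \<open>As \<open>e \<le> d\<close>, a window around any level at or above
    \<open>1 - d\<close> stays to the right of \<open>1 - 2 * d\<close>; hence
    \<open>local_mass\<close> is used with \<open>s = 2 * d\<close>, which is why
    \<open>2 * d < s0\<close> is required.\<close>
  have mass: "prob {y - e<..y + e} \<le> ?c" if "1 - d \<le> y" for y
  proof -
    have "prob {y - e<..y + e} \<le> C * (y + e - (y - e)) * (2 * d) powr (\<beta> - 1)"
      using d e that by (intro local_mass) auto
    then show ?thesis by (simp add: mult_ac)
  qed
  let ?I = "{1 - d - e<..1 - d + e}"
  have iI: "integrable M (\<lambda>\<omega>. indicator ?I (X \<omega>) :: real)"
    by (rule M.integrable_const_bound[where B=1]) auto
  have "(\<integral>\<omega>. \<bar>exceed d r (X \<omega> + \<rho> \<omega>) - exceed d r (X \<omega>)\<bar> \<partial>M) \<le> (\<integral>\<omega>. indicator ?I (X \<omega>) + indicator ?B \<omega> \<partial>M)"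
  proof (rule integral_mono_AE')
    show "integrable M (\<lambda>\<omega>. indicator ?I (X \<omega>) + indicator ?B \<omega> :: real)" using iI iB by simp
    show "AE \<omega> in M. \<bar>exceed d r (X \<omega> + \<rho> \<omega>) - exceed d r (X \<omega>)\<bar> \<le> indicator ?I (X \<omega>) + indicator ?B \<omega>"
      by (rule AE_I2) (auto simp: exceed_iff[OF d(1) d1 r] split: split_indicator)
  qed simp
  also have "\<dots> = (\<integral>x. indicator ?I x \<partial>distr M borel X) + M.prob ?B"
    using iI iB by (subst integral_distr) auto
  also have "\<dots> \<le> ?c + \<pi>" using mass[of "1 - d"] \<pi> by (simp add: distr algebra_simps)
  finally show "(\<integral>\<omega>. \<bar>exceed d r (X \<omega> + \<rho> \<omega>) - exceed d r (X \<omega>)\<bar> \<partial>M) \<le> ?c + \<pi>" .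

  have int: "integrable \<mu> (\<lambda>x. log_excess d r (x + u))" for u
    using log_excess_nonneg[OF d(1) d1 r] log_excess_le[OF d(1) d1 r]
    by (intro integrable_const_bound[where B="?L"] AE_I2) auto
  have shift: "expectation (\<lambda>x. log_excess d r (x + e)) \<le> expectation (\<lambda>x. log_excess d r (x - e)) + ?c * ?L"
  proof (rule expectation_le_of_tail_le)
    fix t assume t: "0 \<le> t" "t < ?L"
    define y where "y = 1 - d * exp (- t)"
    have "d * exp (- t) \<le> d * 1" using d t by (intro mult_left_mono) auto
    then have y: "1 - d \<le> y" by (simp add: y_def)
    have gt: "t < log_excess d r x \<longleftrightarrow> y < x" for x
      unfolding y_def by (rule log_excess_gt_iff[OF d(1) d1 r t])
    have "prob {x \<in> space \<mu>. t < log_excess d r (x + e)} \<le> prob ({x \<in> space \<mu>. t < log_excess d r (x - e)} \<union> {y - e<..y + e})"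
      unfolding gt by (intro finite_measure_mono) auto
    also have "\<dots> \<le> prob {x \<in> space \<mu>. t < log_excess d r (x - e)} + prob {y - e<..y + e}"
      by (rule measure_Un_le) auto
    finally show "prob {x \<in> space \<mu>. t < log_excess d r (x + e)} \<le> prob {x \<in> space \<mu>. t < log_excess d r (x - e)} + ?c"
      using mass[OF y] by linarith
  next
    show "(\<lambda>x. log_excess d r (x + e)) \<in> borel_measurable \<mu>" by measurable
    show "(\<lambda>x. log_excess d r (x - e)) \<in> borel_measurable \<mu>" by measurable
  qed (simp_all add: log_excess_nonneg[OF d(1) d1 r] log_excess_le[OF d(1) d1 r] c L)
  have iX: "integrable M (\<lambda>\<omega>. log_excess d r (X \<omega> + u))" for u
    using int[of u] unfolding distr[symmetric] by (subst (asm) integrable_distr_eq) auto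
  have EX: "(\<integral>\<omega>. log_excess d r (X \<omega> + u) \<partial>M) = expectation (\<lambda>x. log_excess d r (x + u))" for u
    unfolding distr[symmetric] by (subst integral_distr) auto
  \<comment> \<open>On the bad event both values lie in [0, \<open>?L\<close>], so their difference
    is at most \<open>?L\<close>; elsewhere monotonicity applies.\<close>
  have "(\<integral>\<omega>. \<bar>log_excess d r (X \<omega> + \<rho> \<omega>) - log_excess d r (X \<omega>)\<bar> \<partial>M)
    \<le> (\<integral>\<omega>. log_excess d r (X \<omega> + e) - log_excess d r (X \<omega> + (- e)) + ?L * indicator ?B \<omega> \<partial>M)"
  proof (rule integral_mono_AE')
    show "integrable M (\<lambda>\<omega>. log_excess d r (X \<omega> + e) - log_excess d r (X \<omega> + (- e)) + ?L * indicator ?B \<omega>)"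
      using iX[of e] iX[of "- e"] iB by simp
    show "AE \<omega> in M. \<bar>log_excess d r (X \<omega> + \<rho> \<omega>) - log_excess d r (X \<omega>)\<bar>
      \<le> log_excess d r (X \<omega> + e) - log_excess d r (X \<omega> + (- e)) + ?L * indicator ?B \<omega>"
    proof (rule AE_I2)
      fix \<omega> assume \<omega>: "\<omega> \<in> space M"
      note mono = log_excess_mono[OF d(1) d1 r] and nn = log_excess_nonneg[OF d(1) d1 r] and le = log_excess_le[OF d(1) d1 r]
      have m: "log_excess d r (X \<omega> + (- e)) \<le> log_excess d r (X \<omega>)" "log_excess d r (X \<omega>) \<le> log_excess d r (X \<omega> + e)"
        using e by (auto intro!: mono)
      show "\<bar>log_excess d r (X \<omega> + \<rho> \<omega>) - log_excess d r (X \<omega>)\<bar>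
        \<le> log_excess d r (X \<omega> + e) - log_excess d r (X \<omega> + (- e)) + ?L * indicator ?B \<omega>"
      proof (cases "\<bar>\<rho> \<omega>\<bar> > e")
        case True
        then show ?thesis
          using \<omega> m nn[of "X \<omega>"] le[of "X \<omega>"] nn[of "X \<omega> + \<rho> \<omega>"] le[of "X \<omega> + \<rho> \<omega>"] by simp
      next
        case False
        then have "log_excess d r (X \<omega> + (- e)) \<le> log_excess d r (X \<omega> + \<rho> \<omega>)" "log_excess d r (X \<omega> + \<rho> \<omega>) \<le> log_excess d r (X \<omega> + e)"
          by (auto intro!: mono)
        then show ?thesis using m False by simp
      qed
    qed
    show "AE \<omega> in M. 0 \<le> log_excess d r (X \<omega> + e) - log_excess d r (X \<omega> + (- e)) + ?L * indicator ?B \<omega>"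
      using L e by (intro AE_I2 add_nonneg_nonneg) (auto intro!: log_excess_mono[OF d(1) d1 r])
  qed
  also have "\<dots> = expectation (\<lambda>x. log_excess d r (x + e)) - expectation (\<lambda>x. log_excess d r (x - e)) + ?L * M.prob ?B"
    using iX[of e] iX[of "- e"] iB EX[of e] EX[of "- e"] by simp
  also have "\<dots> \<le> ?c * ?L + ?L * \<pi>"
    using shift mult_left_mono[OF \<pi> L] by linarith
  also have "\<dots> = (?c + \<pi>) * ?L" by (simp add: algebra_simps)
  finally show "(\<integral>\<omega>. \<bar>log_excess d r (X \<omega> + \<rho> \<omega>) - log_excess d r (X \<omega>)\<bar> \<partial>M) \<le> (?c + \<pi>) * ?L" .
qed

end

section \<open>The perturbed sample\<close>

text \<open>The threshold \<open>e = \<delta> q\<close> balances the mass \<open>\<delta>\<^sup>\<beta> e / \<delta>\<close> of a window of width \<open>e\<close> at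
  \<open>1 - \<delta>\<close> against \<open>chi / e\<^sup>p\<close>, which gives \<open>q = \<eta>\<close>; the extra summand in \<open>q\<close> is negligible and
  keeps \<open>e\<close> positive when \<open>chi = 0\<close>. The sign of \<open>chi'\<close> is not known, hence the \<open>max 0\<close>.\<close>

lemma perturbation_scale_exists:
  fixes \<delta> chi chi' :: "nat \<Rightarrow> real"
  assumes \<delta>_pos: "\<And>N. \<delta> N > 0" and \<delta>_lim: "\<delta> \<longlonglongrightarrow> 0"
    and N\<delta>: "filterlim (\<lambda>N. real N * \<delta> N powr \<beta>) at_top sequentially"
    and p: "p \<ge> 1" and chi: "\<And>N. chi N \<ge> 0" and K: "0 \<le> K"
    and rate: "(\<lambda>N. sqrt (real N * \<delta> N powr \<beta>) *
                 max (chi' N / \<delta> N powr \<beta>) ((chi N / \<delta> N powr (p + \<beta>)) powr (1 / (p + 1))) *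
                 ln (\<delta> N)) \<longlonglongrightarrow> 0"
  obtains e Q where
    "\<forall>\<^sub>F N in sequentially. 0 < e N \<and> e N \<le> \<delta> N \<and>
      K * e N * \<delta> N powr (\<beta> - 1) + (chi N / e N powr p + chi' N) \<le> \<delta> N powr \<beta> * Q N"
    "(\<lambda>N. sqrt (real N * \<delta> N powr \<beta>) * \<bar>ln (\<delta> N)\<bar> * Q N) \<longlonglongrightarrow> 0" "\<And>N. 0 \<le> Q N"
proof -
  define s where "s N = sqrt (real N * \<delta> N powr \<beta>)" for N
  define \<eta> where "\<eta> N = (chi N / \<delta> N powr (p + \<beta>)) powr (1 / (p + 1))" for N
  define x where "x N = max 0 (chi' N / \<delta> N powr \<beta>)" for N
  define q where "q N = \<eta> N + 1 / ((s N)\<^sup>2 * (1 + \<bar>ln (\<delta> N)\<bar>))" for N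
  \<comment> \<open>Relative to \<open>\<delta> N powr \<beta>\<close>, the window contributes
    \<open>K * q N\<close>, the \<open>chi\<close> term \<open>q N\<close> and the
    \<open>chi'\<close> term \<open>x N\<close>.\<close>
  define Q where "Q N = (K + 1) * q N + x N" for N
  have s_top: "filterlim s at_top sequentially"
    unfolding s_def by (rule filterlim_compose[OF sqrt_at_top N\<delta>])
  have s_nonneg: "0 \<le> s N" for N using \<delta>_pos[of N] by (simp add: s_def)
  have \<eta>_nonneg: "0 \<le> \<eta> N" for N by (simp add: \<eta>_def)
  have q_nonneg: "0 \<le> q N" for N using \<eta>_nonneg by (simp add: q_def)
  have s_inv: "(\<lambda>N. 1 / s N) \<longlonglongrightarrow> 0"
    using s_top by (intro tendsto_divide_0[OF tendsto_const] filterlim_at_top_imp_at_infinity)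
  have rate': "(\<lambda>N. s N * \<bar>ln (\<delta> N)\<bar> * max (chi' N / \<delta> N powr \<beta>) (\<eta> N)) \<longlonglongrightarrow> 0"
  proof -
    have "(\<lambda>N. \<bar>s N * max (chi' N / \<delta> N powr \<beta>) (\<eta> N) * ln (\<delta> N)\<bar>) \<longlonglongrightarrow> 0"
      using tendsto_rabs_zero[OF rate] unfolding s_def \<eta>_def .
    moreover have "0 \<le> max (chi' N / \<delta> N powr \<beta>) (\<eta> N)" for N using \<eta>_nonneg[of N] by simp
    ultimately show ?thesis using s_nonneg by (simp add: abs_mult mult_ac)
  qed
  have s\<eta>: "(\<lambda>N. s N * \<bar>ln (\<delta> N)\<bar> * \<eta> N) \<longlonglongrightarrow> 0"
    using s_nonneg \<eta>_nonneg
    by (intro tendsto_sandwich[OF _ _ tendsto_const rate'] always_eventually allI mult_left_mono) auto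
  have sx: "(\<lambda>N. s N * \<bar>ln (\<delta> N)\<bar> * x N) \<longlonglongrightarrow> 0"
  proof (rule tendsto_sandwich[OF _ _ tendsto_const rate'])
    have "x N \<le> max (chi' N / \<delta> N powr \<beta>) (\<eta> N)" for N
      using \<eta>_nonneg[of N] by (auto simp: x_def)
    then show "\<forall>\<^sub>F N in sequentially. s N * \<bar>ln (\<delta> N)\<bar> * x N
        \<le> s N * \<bar>ln (\<delta> N)\<bar> * max (chi' N / \<delta> N powr \<beta>) (\<eta> N)"
      using s_nonneg by (intro always_eventually allI mult_left_mono) auto
  qed (use s_nonneg in \<open>auto simp: x_def\<close>)
  have sr: "(\<lambda>N. s N * \<bar>ln (\<delta> N)\<bar> * (1 / ((s N)\<^sup>2 * (1 + \<bar>ln (\<delta> N)\<bar>)))) \<longlonglongrightarrow> 0"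
  proof (rule tendsto_sandwich[OF _ _ tendsto_const s_inv])
    show "\<forall>\<^sub>F N in sequentially. s N * \<bar>ln (\<delta> N)\<bar> * (1 / ((s N)\<^sup>2 * (1 + \<bar>ln (\<delta> N)\<bar>))) \<le> 1 / s N"
    proof (intro always_eventually allI)
      fix N
      \<comment> \<open>Also true at \<open>y = 0\<close>, where division by zero makes both sides
        0; \<open>s 0\<close> is 0.\<close>
      have "y * l * (1 / (y\<^sup>2 * c)) = 1 / y * (l / c)" for y l c :: real
        by (cases "y = 0") (auto simp: power2_eq_square)
      then have "s N * \<bar>ln (\<delta> N)\<bar> * (1 / ((s N)\<^sup>2 * (1 + \<bar>ln (\<delta> N)\<bar>))) = 1 / s N * (\<bar>ln (\<delta> N)\<bar> / (1 + \<bar>ln (\<delta> N)\<bar>))" .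
      also have "\<dots> \<le> 1 / s N * 1"
        using s_nonneg by (intro mult_left_mono) (auto simp: divide_le_eq)
      finally show "s N * \<bar>ln (\<delta> N)\<bar> * (1 / ((s N)\<^sup>2 * (1 + \<bar>ln (\<delta> N)\<bar>))) \<le> 1 / s N" by simp
    qed
  qed (use s_nonneg in auto)
  have sq: "(\<lambda>N. s N * \<bar>ln (\<delta> N)\<bar> * q N) \<longlonglongrightarrow> 0"
    using tendsto_add[OF s\<eta> sr] by (simp add: q_def algebra_simps)
  have sQ: "(\<lambda>N. s N * \<bar>ln (\<delta> N)\<bar> * Q N) \<longlonglongrightarrow> 0"
    using tendsto_add[OF tendsto_mult_left[OF sq, of "K + 1"] sx] by (simp add: Q_def algebra_simps)
  have ln_top: "filterlim (\<lambda>N. ln (\<delta> N)) at_bot sequentially"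
    using \<delta>_lim \<delta>_pos less_imp_neq[OF \<delta>_pos, symmetric]
    by (intro filterlim_compose[OF ln_at_0]) (auto simp: filterlim_at)
  then have ln_ge: "\<forall>\<^sub>F N in sequentially. ln (\<delta> N) \<le> - 1" by (simp add: filterlim_at_bot)
  have s_ge: "\<forall>\<^sub>F N in sequentially. 1 \<le> s N" using s_top by (simp add: filterlim_at_top)
  have sq1: "\<forall>\<^sub>F N in sequentially. s N * \<bar>ln (\<delta> N)\<bar> * q N < 1" using sq by (rule order_tendstoD) simp
  show thesis
  proof (rule that[of "\<lambda>N. \<delta> N * q N" Q])
    show "(\<lambda>N. sqrt (real N * \<delta> N powr \<beta>) * \<bar>ln (\<delta> N)\<bar> * Q N) \<longlonglongrightarrow> 0"
      using sQ unfolding s_def .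
    show "0 \<le> Q N" for N using q_nonneg[of N] K by (simp add: Q_def x_def)
    show "\<forall>\<^sub>F N in sequentially. 0 < \<delta> N * q N \<and> \<delta> N * q N \<le> \<delta> N \<and>
      K * (\<delta> N * q N) * \<delta> N powr (\<beta> - 1) + (chi N / (\<delta> N * q N) powr p + chi' N) \<le> \<delta> N powr \<beta> * Q N"
      using ln_ge s_ge sq1
    proof eventually_elim
      case (elim N)
      have d: "0 < \<delta> N" by (rule \<delta>_pos)
      have "0 < 1 / ((s N)\<^sup>2 * (1 + \<bar>ln (\<delta> N)\<bar>))" using elim by (intro divide_pos_pos mult_pos_pos) auto
      then have q: "0 < q N" using \<eta>_nonneg[of N] unfolding q_def by linarith
      \<comment> \<open>The rate, applied where both \<open>s N\<close> and
        \<open>\<bar>ln (\<delta> N)\<bar>\<close> are at least 1, forces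
        \<open>q N \<le> 1\<close>, that is, a window no wider than \<delta>.\<close>
      have "1 * 1 * q N \<le> s N * \<bar>ln (\<delta> N)\<bar> * q N" using elim q by (intro mult_right_mono mult_mono) auto
      then have q1: "q N \<le> 1" using elim by simp
      \<comment> \<open>By its definition \<open>\<eta> N\<close> solves this equation. Replacing it
        by the larger \<open>q N\<close> gives an inequality, which rearranges to the bound on
        \<open>chi N\<close> over the p-th power of \<open>\<delta> N * q N\<close>.\<close>
      have "chi N / \<delta> N powr (p + \<beta>) = \<eta> N powr (p + 1)"
        unfolding \<eta>_def powr_powr using p chi[of N] d by simp
      also have "\<dots> \<le> q N powr (p + 1)"
        using p \<eta>_nonneg[of N] by (intro powr_mono2) (auto simp: q_def)
      finally have "chi N \<le> q N powr (p + 1) * \<delta> N powr (p + \<beta>)" using d by (simp add: divide_le_eq)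
      also have "\<dots> = (\<delta> N powr \<beta> * q N) * (\<delta> N * q N) powr p"
        using q d by (simp add: powr_add powr_mult)
      finally have c: "chi N / (\<delta> N * q N) powr p \<le> \<delta> N powr \<beta> * q N"
        using q d by (simp add: divide_le_eq)
      have c': "chi' N \<le> \<delta> N powr \<beta> * x N"
        using d by (simp add: x_def max_def field_simps)
      have k: "K * (\<delta> N * q N) * \<delta> N powr (\<beta> - 1) = \<delta> N powr \<beta> * (K * q N)"
        using d by (simp add: powr_diff)
      show ?case unfolding k Q_def using q q1 d c c' by (simp add: algebra_simps)
    qed
  qed
qed

section \<open>Limits of the unperturbed score and log-excess sums\<close>

locale pareto_sample = prob_space M + tail: pareto_tail \<mu> \<beta> \<nu> \<kappa> C s0 r
  for M :: "'s measure" and \<mu> :: "real measure" and \<beta> \<nu> \<kappa> C s0 r :: real +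
  fixes a :: "nat \<Rightarrow> 's \<Rightarrow> real" and \<delta> :: "nat \<Rightarrow> real"
  assumes indep: "indep_vars (\<lambda>_. borel) a {1..}"
    and distr_a: "\<And>i. i \<ge> 1 \<Longrightarrow> distr M borel (a i) = \<mu>"
    and \<delta>_pos: "\<And>N. \<delta> N > 0" and \<delta>_lim: "\<delta> \<longlonglongrightarrow> 0"
    and N\<delta>_inf: "filterlim (\<lambda>N. real N * \<delta> N powr \<beta>) at_top sequentially"
    and N\<delta>_zero: "(\<lambda>N. real N * \<delta> N powr (\<beta> + 2 * min \<nu> ((r - 1) * \<beta>))) \<longlonglongrightarrow> 0"
begin

definition scale :: "nat \<Rightarrow> real" where "scale N = sqrt (real N * \<delta> N powr \<beta>)"

lemma a_measurable: "i \<ge> 1 \<Longrightarrow> a i \<in> borel_measurable M"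
  using indep by (auto simp: indep_vars_def)

lemma scale_nonneg: "0 \<le> scale N"
  by (simp add: scale_def)

lemma scale_square: "(scale N)\<^sup>2 = real N * \<delta> N powr \<beta>"
  by (simp add: scale_def)

lemma scale_at_top: "filterlim scale at_top sequentially"
  unfolding scale_def[abs_def] by (rule filterlim_compose[OF sqrt_at_top N\<delta>_inf])

lemma scale_inverse: "(\<lambda>N. 1 / scale N) \<longlonglongrightarrow> 0"
  using scale_at_top by (intro tendsto_divide_0[OF tendsto_const] filterlim_at_top_imp_at_infinity)

lemma eventually_scale_ge_1: "\<forall>\<^sub>F N in sequentially. 1 \<le> scale N"
  using scale_at_top by (simp add: filterlim_at_top)

lemma \<delta>_at_right: "filterlim \<delta> (at_right 0) sequentially"
  using \<delta>_lim \<delta>_pos less_imp_neq[OF \<delta>_pos, symmetric] by (auto simp: filterlim_at)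

lemma eventually_\<delta>: "eventually P (at_right 0) \<Longrightarrow> \<forall>\<^sub>F N in sequentially. P (\<delta> N)"
  using \<delta>_at_right by (auto simp: filterlim_iff)

lemma expectation_a: "f \<in> borel_measurable borel \<Longrightarrow> i \<ge> 1 \<Longrightarrow> expectation (\<lambda>\<omega>. f (a i \<omega>)) = (\<integral>x. f x \<partial>\<mu>)"
  for f :: "real \<Rightarrow> real"
  using a_measurable[of i] distr_a[of i, symmetric] by (simp add: integral_distr)

lemma integrable_a: "integrable \<mu> f \<Longrightarrow> i \<ge> 1 \<Longrightarrow> integrable M (\<lambda>\<omega>. f (a i \<omega>))" for f :: "real \<Rightarrow> real"
  by (rule integrable_distr[where M'=borel]) (auto simp: a_measurable distr_a)

lemma indep_compose:
  assumes "\<And>i. f i \<in> borel_measurable borel"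
  shows "indep_vars (\<lambda>_. borel) (\<lambda>i \<omega>. f i (a i \<omega>)) {1..N}"
  by (rule indep_vars_compose2[OF indep_vars_subset[OF indep]]) (use assms in auto)

lemma integrable_score_power: "integrable \<mu> (\<lambda>x. score \<beta> (\<delta> N) r x ^ k)"
proof (rule tail.integrable_const_bound)
  show "AE x in \<mu>. norm (score \<beta> (\<delta> N) r x ^ k) \<le> (1 + \<beta> * ((r - 1) * \<bar>ln (\<delta> N)\<bar>)) ^ k"
    using score_bounded[OF \<delta>_pos[of N] tail.r, of \<beta>] tail.\<beta>
    by (auto simp: power_abs intro!: AE_I2 power_mono)
qed simp

text \<open>With m the minimum in the exponent, N \<delta>^(\<beta> + m) / s = s \<delta>^m, which
  is the square root of the quantity in \<open>N\<delta>_zero\<close>.\<close>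

lemma score_mean_scaled: "(\<lambda>N. real N * (\<integral>x. score \<beta> (\<delta> N) r x \<partial>\<mu>) / scale N) \<longlonglongrightarrow> 0"
proof (rule Lim_null_comparison)
  let ?m = "min \<nu> ((r - 1) * \<beta>)"
  show "(\<lambda>N. (2 * C + \<kappa>) * sqrt (real N * \<delta> N powr (\<beta> + 2 * ?m))) \<longlonglongrightarrow> 0"
    using tendsto_real_sqrt[OF N\<delta>_zero] by (intro tendsto_mult_right_zero) simp
  show "\<forall>\<^sub>F N in sequentially. norm (real N * (\<integral>x. score \<beta> (\<delta> N) r x \<partial>\<mu>) / scale N) \<le>
    (2 * C + \<kappa>) * sqrt (real N * \<delta> N powr (\<beta> + 2 * ?m))"
    using eventually_\<delta>[OF tail.eventually_small] eventually_scale_ge_1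
  proof eventually_elim
    case (elim N)
    have e: "\<bar>\<integral>x. score \<beta> (\<delta> N) r x \<partial>\<mu>\<bar> \<le> (2 * C + \<kappa>) * \<delta> N powr (\<beta> + ?m)"
      using elim by (intro tail.expectation_score_le) auto
    have sc: "sqrt (real N * \<delta> N powr (\<beta> + 2 * ?m)) = scale N * \<delta> N powr ?m"
    proof -
      have "\<delta> N powr (\<beta> + 2 * m) = \<delta> N powr \<beta> * (\<delta> N powr m)\<^sup>2" for m
        by (simp only: mult_2 powr_add power2_eq_square)
      then have "real N * \<delta> N powr (\<beta> + 2 * m) = (scale N * \<delta> N powr m)\<^sup>2" for m
        unfolding power_mult_distrib scale_square by simp
      then show ?thesis using scale_nonneg[of N] by simp
    qed
    have "norm (real N * (\<integral>x. score \<beta> (\<delta> N) r x \<partial>\<mu>) / scale N)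
      = real N / scale N * \<bar>\<integral>x. score \<beta> (\<delta> N) r x \<partial>\<mu>\<bar>"
      using elim by (simp add: abs_mult)
    also have "\<dots> \<le> real N / scale N * ((2 * C + \<kappa>) * \<delta> N powr (\<beta> + ?m))"
      using elim by (intro mult_left_mono e) auto
    also have "\<dots> = (2 * C + \<kappa>) * ((scale N)\<^sup>2 / scale N * \<delta> N powr ?m)"
      unfolding scale_square by (simp add: powr_add)
    also have "\<dots> = (2 * C + \<kappa>) * sqrt (real N * \<delta> N powr (\<beta> + 2 * ?m))"
      unfolding sc using elim by (simp add: power2_eq_square)
    finally show ?case .
  qed
qed

lemma score_square_scaled: "(\<lambda>N. real N * (\<integral>x. (score \<beta> (\<delta> N) r x)\<^sup>2 \<partial>\<mu>) / (scale N)\<^sup>2) \<longlonglongrightarrow> \<kappa>"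
proof (rule Lim_transform_eventually[OF filterlim_compose[OF tail.score_square_tendsto \<delta>_at_right]])
  show "\<forall>\<^sub>F N in sequentially. (\<integral>x. (score \<beta> (\<delta> N) r x)\<^sup>2 \<partial>\<mu>) / \<delta> N powr \<beta> =
    real N * (\<integral>x. (score \<beta> (\<delta> N) r x)\<^sup>2 \<partial>\<mu>) / (scale N)\<^sup>2"
    using eventually_gt_at_top[of 0] by eventually_elim (simp add: scale_square)
qed

text \<open>Lyapunov's condition: third moments are of order \<delta>^\<beta>, like second moments,
  so the sum is of order s^2 / s^3.\<close>

lemma score_cube_scaled: "(\<lambda>N. real N * (\<integral>x. \<bar>score \<beta> (\<delta> N) r x\<bar> ^ 3 \<partial>\<mu>) / (scale N) ^ 3) \<longlonglongrightarrow> 0"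
proof (rule Lim_null_comparison)
  show "(\<lambda>N. 14 * \<kappa> * (1 / scale N)) \<longlonglongrightarrow> 0" by (intro tendsto_mult_right_zero scale_inverse)
  show "\<forall>\<^sub>F N in sequentially. norm (real N * (\<integral>x. \<bar>score \<beta> (\<delta> N) r x\<bar> ^ 3 \<partial>\<mu>) / (scale N) ^ 3) \<le> 14 * \<kappa> * (1 / scale N)"
    using eventually_\<delta>[OF tail.eventually_small] eventually_scale_ge_1
  proof eventually_elim
    case (elim N)
    have "norm (real N * (\<integral>x. \<bar>score \<beta> (\<delta> N) r x\<bar> ^ 3 \<partial>\<mu>) / (scale N) ^ 3)
      = real N / (scale N) ^ 3 * (\<integral>x. \<bar>score \<beta> (\<delta> N) r x\<bar> ^ 3 \<partial>\<mu>)"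
      using elim by (simp add: abs_mult)
    also have "\<dots> \<le> real N / (scale N) ^ 3 * (14 * \<kappa> * \<delta> N powr \<beta>)"
      using elim by (intro mult_left_mono tail.expectation_score_cube_le) auto
    also have "\<dots> = 14 * \<kappa> * ((scale N)\<^sup>2 / (scale N) ^ 3)" unfolding scale_square by simp
    also have "\<dots> = 14 * \<kappa> * (1 / scale N)" using elim by (simp add: power2_eq_square power3_eq_cube)
    finally show ?case .
  qed
qed

definition score_sum :: "nat \<Rightarrow> 's \<Rightarrow> real" where
  "score_sum N \<omega> = (\<Sum>i=1..N. score \<beta> (\<delta> N) r (a i \<omega>)) / scale N"

definition log_sum :: "nat \<Rightarrow> 's \<Rightarrow> real" where
  "log_sum N \<omega> = (\<Sum>i=1..N. log_excess (\<delta> N) r (a i \<omega>)) / (scale N)\<^sup>2"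

lemma score_sum_measurable[measurable]: "score_sum N \<in> borel_measurable M"
proof -
  have "(\<lambda>\<omega>. score \<beta> (\<delta> N) r (a i \<omega>)) \<in> borel_measurable M" if "i \<in> {1..N}" for i
    using a_measurable[of i] that by (intro measurable_compose[OF _ score_measurable]) auto
  then show ?thesis unfolding score_sum_def[abs_def] by (intro borel_measurable_divide borel_measurable_sum) auto
qed

lemma log_sum_measurable[measurable]: "log_sum N \<in> borel_measurable M"
proof -
  have "(\<lambda>\<omega>. log_excess (\<delta> N) r (a i \<omega>)) \<in> borel_measurable M" if "i \<in> {1..N}" for i
    using a_measurable[of i] that by (intro measurable_compose[OF _ log_excess_measurable]) auto
  then show ?thesis unfolding log_sum_def[abs_def] by (intro borel_measurable_divide borel_measurable_sum) auto
qed

lemma char_score_sum_tendsto: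
  "(\<lambda>N. char (distr M borel (score_sum N)) t) \<longlonglongrightarrow> complex_of_real (exp (- (t\<^sup>2 * \<kappa>) / 2))"
proof -
  define Y where "Y N x = score \<beta> (\<delta> N) r x / scale N" for N x
  have [measurable]: "Y N \<in> borel_measurable borel" for N unfolding Y_def[abs_def] by measurable
  define X where "X N i \<omega> = Y N (a i \<omega>)" for N i \<omega>
  let ?\<mu> = "\<lambda>N. distr \<mu> borel (Y N)"
  have pow: "integrable \<mu> (\<lambda>x. Y N x ^ k)" for N k
    unfolding Y_def power_divide using integrable_score_power by simp
  have int: "(\<integral>x. f x \<partial>?\<mu> N) = (\<integral>x. f (Y N x) \<partial>\<mu>)" if "f \<in> borel_measurable borel" for f :: "real \<Rightarrow> real" and N
    using that by (subst integral_distr) auto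
  have "(\<lambda>N. char (distr M borel (\<lambda>\<omega>. \<Sum>i=1..N. X N i \<omega>)) t) \<longlonglongrightarrow> complex_of_real (exp (- (t\<^sup>2 * \<kappa>) / 2))"
  proof (rule char_sum_row_iid_tendsto[where \<mu>="?\<mu>"])
    show "indep_vars (\<lambda>_. borel) (X N) {1..N}" for N
      unfolding X_def[abs_def] by (rule indep_compose) simp
    show "distr M borel (X N i) = ?\<mu> N" if "i \<in> {1..N}" for N i
      unfolding X_def[abs_def] using that distr_a[of i, symmetric] a_measurable[of i]
      by (simp add: distr_distr comp_def)
    show "real_distribution (?\<mu> N)" for N by (rule tail.real_distribution_distr) simp
    show "integrable (?\<mu> N) (\<lambda>x. x ^ k)" for N k
      using pow[of N k] by (subst integrable_distr_eq) auto
    show "(\<lambda>N. real N * (\<integral>x. x \<partial>?\<mu> N)) \<longlonglongrightarrow> 0"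
      using score_mean_scaled by (simp add: int Y_def)
    show "(\<lambda>N. real N * (\<integral>x. x\<^sup>2 \<partial>?\<mu> N)) \<longlonglongrightarrow> \<kappa>"
      using score_square_scaled by (simp add: int Y_def power_divide)
    show "(\<lambda>N. real N * (\<integral>x. \<bar>x\<bar> ^ 3 \<partial>?\<mu> N)) \<longlonglongrightarrow> 0"
      using score_cube_scaled by (simp add: int Y_def power_divide scale_nonneg)
    show "0 \<le> \<kappa>" using tail.\<kappa> by simp
  qed
  then show ?thesis by (simp add: score_sum_def[abs_def] X_def Y_def sum_divide_distrib)
qed

text \<open>Provides the tightness of the numerator for the quotient argument. The sum is not
  centred, so its mean is split off by (x + y)^2 \<le> 2 x^2 + 2 y^2; the bound is the limit
  \<open>2 * \<kappa>\<close> of the right-hand side plus slack.\<close>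

lemma score_sum_square:
  "integrable M (\<lambda>\<omega>. (score_sum N \<omega>)\<^sup>2)"
  "\<forall>\<^sub>F N in sequentially. expectation (\<lambda>\<omega>. (score_sum N \<omega>)\<^sup>2) \<le> 2 * \<kappa> + 2"
proof -
  define X where "X N i \<omega> = score \<beta> (\<delta> N) r (a i \<omega>) / scale N" for N i \<omega>
  define m where "m N = (\<integral>x. score \<beta> (\<delta> N) r x \<partial>\<mu>) / scale N" for N
  define v where "v N = (\<integral>x. (score \<beta> (\<delta> N) r x)\<^sup>2 \<partial>\<mu>) / (scale N)\<^sup>2" for N
  have sum: "score_sum N \<omega> = (\<Sum>i\<in>{1..N}. X N i \<omega>)" for N \<omega>
    by (simp add: score_sum_def X_def sum_divide_distrib)
  have ind: "indep_vars (\<lambda>_. borel) (X N) {1..N}" for N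
    unfolding X_def[abs_def] by (rule indep_compose) simp
  have i2: "integrable M (\<lambda>\<omega>. (X N i \<omega>)\<^sup>2)" if "i \<in> {1..N}" for N i
    unfolding X_def power_divide using integrable_a[OF integrable_score_power[of N 2], of i] that by simp
  have e1: "expectation (X N i) = m N" if "i \<in> {1..N}" for N i
    unfolding X_def[abs_def] m_def using expectation_a[OF score_measurable, of i] that by simp
  have e2: "expectation (\<lambda>\<omega>. (X N i \<omega>)\<^sup>2) = v N" if "i \<in> {1..N}" for N i
    unfolding X_def[abs_def] v_def power_divide using expectation_a[of "\<lambda>x. (score \<beta> (\<delta> N) r x)\<^sup>2" i] that by simp
  have c: "integrable M (\<lambda>\<omega>. (score_sum N \<omega> - N * m N)\<^sup>2)"
    "expectation (\<lambda>\<omega>. (score_sum N \<omega> - N * m N)\<^sup>2) \<le> N * v N" for N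
    using square_sum_iid_le[OF _ ind i2 e1 e2, of N] by (simp_all add: sum)
  have le: "(score_sum N \<omega>)\<^sup>2 \<le> 2 * (score_sum N \<omega> - N * m N)\<^sup>2 + 2 * (N * m N)\<^sup>2" for N \<omega>
    using sum_squares_bound[of "score_sum N \<omega> - N * m N" "N * m N"]
    by (simp add: power2_eq_square algebra_simps)
  have ic: "integrable M (\<lambda>\<omega>. 2 * (score_sum N \<omega> - N * m N)\<^sup>2 + 2 * (N * m N)\<^sup>2)" for N
    using c(1) by simp
  show int: "integrable M (\<lambda>\<omega>. (score_sum N \<omega>)\<^sup>2)" for N
    by (rule Bochner_Integration.integrable_bound[OF ic[of N]]) (use le in auto)
  have b: "expectation (\<lambda>\<omega>. (score_sum N \<omega>)\<^sup>2) \<le> 2 * (N * v N) + 2 * (N * m N)\<^sup>2" for N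
  proof -
    have "expectation (\<lambda>\<omega>. (score_sum N \<omega>)\<^sup>2) \<le> expectation (\<lambda>\<omega>. 2 * (score_sum N \<omega> - N * m N)\<^sup>2 + 2 * (N * m N)\<^sup>2)"
      by (intro integral_mono int ic le)
    also have "\<dots> = 2 * expectation (\<lambda>\<omega>. (score_sum N \<omega> - N * m N)\<^sup>2) + 2 * (N * m N)\<^sup>2"
      using c(1)[of N] by (simp add: prob_space)
    finally show ?thesis using c(2)[of N] by linarith
  qed
  have "(\<lambda>N. 2 * (N * v N) + 2 * (N * m N)\<^sup>2) \<longlonglongrightarrow> 2 * \<kappa> + 2 * 0\<^sup>2"
    using score_mean_scaled score_square_scaled unfolding v_def m_def
    by (intro tendsto_intros) simp_all
  then have "\<forall>\<^sub>F N in sequentially. 2 * (N * v N) + 2 * (N * m N)\<^sup>2 < 2 * \<kappa> + 2"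
    by (rule order_tendstoD) simp
  then show "\<forall>\<^sub>F N in sequentially. expectation (\<lambda>\<omega>. (score_sum N \<omega>)\<^sup>2) \<le> 2 * \<kappa> + 2"
    by eventually_elim (rule order_trans[OF b], simp)
qed

definition log_mean :: "nat \<Rightarrow> real" where
  "log_mean N = N * (\<integral>x. log_excess (\<delta> N) r x \<partial>\<mu>) / (scale N)\<^sup>2"

lemma log_mean_tendsto: "log_mean \<longlonglongrightarrow> \<kappa> / \<beta>"
  unfolding log_mean_def[abs_def]
proof (rule Lim_transform_eventually[OF filterlim_compose[OF tail.log_excess_tendsto \<delta>_at_right]])
  show "\<forall>\<^sub>F N in sequentially. (\<integral>x. log_excess (\<delta> N) r x \<partial>\<mu>) / \<delta> N powr \<beta> =
    real N * (\<integral>x. log_excess (\<delta> N) r x \<partial>\<mu>) / (scale N)\<^sup>2"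
    using eventually_gt_at_top[of 0] by eventually_elim (simp add: scale_square)
qed

text \<open>The variance is at most N E(\<phi>^2) / s^4, and N E(\<phi>^2) is of order s^2, so it
  decays like 1 / s^2.\<close>

lemma log_sum_centered_square:
  "integrable M (\<lambda>\<omega>. (log_sum N \<omega> - log_mean N)\<^sup>2)"
  "(\<lambda>N. expectation (\<lambda>\<omega>. (log_sum N \<omega> - log_mean N)\<^sup>2)) \<longlonglongrightarrow> 0"
proof -
  define X where "X N i \<omega> = log_excess (\<delta> N) r (a i \<omega>) / (scale N)\<^sup>2" for N i \<omega>
  define v where "v N = (\<integral>x. (log_excess (\<delta> N) r x)\<^sup>2 \<partial>\<mu>) / ((scale N)\<^sup>2)\<^sup>2" for N
  have sum: "log_sum N \<omega> = (\<Sum>i\<in>{1..N}. X N i \<omega>)" for N \<omega>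
    by (simp add: log_sum_def X_def sum_divide_distrib)
  have ind: "indep_vars (\<lambda>_. borel) (X N) {1..N}" for N
    unfolding X_def[abs_def] by (rule indep_compose) simp
  have i2: "integrable M (\<lambda>\<omega>. (X N i \<omega>)\<^sup>2)" if "i \<in> {1..N}" for N i
    unfolding X_def power_divide using integrable_a[OF tail.integrable_log_excess_power[OF \<delta>_pos[of N], of 2], of i] that by simp
  have e1: "expectation (X N i) = (\<integral>x. log_excess (\<delta> N) r x \<partial>\<mu>) / (scale N)\<^sup>2" if "i \<in> {1..N}" for N i
    unfolding X_def[abs_def] using expectation_a[OF log_excess_measurable, of i] that by simp
  have e2: "expectation (\<lambda>\<omega>. (X N i \<omega>)\<^sup>2) = v N" if "i \<in> {1..N}" for N i
    unfolding X_def[abs_def] v_def power_divide using expectation_a[of "\<lambda>x. (log_excess (\<delta> N) r x)\<^sup>2" i] that by simp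
  have c: "integrable M (\<lambda>\<omega>. (log_sum N \<omega> - log_mean N)\<^sup>2)"
    "expectation (\<lambda>\<omega>. (log_sum N \<omega> - log_mean N)\<^sup>2) \<le> N * v N" for N
    using square_sum_iid_le[OF _ ind i2 e1 e2, of N] by (simp_all add: sum log_mean_def)
  show "integrable M (\<lambda>\<omega>. (log_sum N \<omega> - log_mean N)\<^sup>2)" by (rule c)
  show "(\<lambda>N. expectation (\<lambda>\<omega>. (log_sum N \<omega> - log_mean N)\<^sup>2)) \<longlonglongrightarrow> 0"
  proof (rule tendsto_sandwich[OF _ _ tendsto_const])
    show "\<forall>\<^sub>F N in sequentially. expectation (\<lambda>\<omega>. (log_sum N \<omega> - log_mean N)\<^sup>2) \<le> N * v N"
      using c(2) by simp
    have "(\<lambda>N. (\<integral>x. (log_excess (\<delta> N) r x)\<^sup>2 \<partial>\<mu>) / \<delta> N powr \<beta> * (1 / scale N)\<^sup>2) \<longlonglongrightarrow> \<kappa> * (2 / \<beta>\<^sup>2) * 0\<^sup>2"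
      by (intro tendsto_intros scale_inverse filterlim_compose[OF tail.log_excess_square_tendsto \<delta>_at_right])
    moreover have "\<forall>\<^sub>F N in sequentially. (\<integral>x. (log_excess (\<delta> N) r x)\<^sup>2 \<partial>\<mu>) / \<delta> N powr \<beta> * (1 / scale N)\<^sup>2 = N * v N"
      using eventually_gt_at_top[of 0]
    proof eventually_elim
      case (elim N)
      have "(1 / scale N)\<^sup>2 = 1 / (real N * \<delta> N powr \<beta>)" by (simp add: power_divide scale_square)
      then show ?case using elim \<delta>_pos[of N] unfolding v_def scale_square
        by (simp add: power2_eq_square)
    qed
    ultimately show "(\<lambda>N. N * v N) \<longlonglongrightarrow> 0" by (simp add: Lim_transform_eventually)
  qed simp
qed

section \<open>Transfer to the perturbed estimator\<close>

lemma beta_est_weak_conv: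
  fixes \<rho> :: "nat \<Rightarrow> nat \<Rightarrow> 's \<Rightarrow> real" and chi chi' :: "nat \<Rightarrow> real"
  assumes \<rho>_rv: "\<And>N i. i \<in> {1..N} \<Longrightarrow> \<rho> N i \<in> borel_measurable M"
    and p: "p \<ge> 1"
    and \<rho>_tail: "\<And>N i e. i \<in> {1..N} \<Longrightarrow> 0 < e \<Longrightarrow> e < 1 \<Longrightarrow>
        prob {\<omega> \<in> space M. \<bar>\<rho> N i \<omega>\<bar> > e} \<le> chi N / e powr p + chi' N"
    and chi: "\<And>N. chi N \<ge> 0"
    and rate: "(\<lambda>N. scale N * max (chi' N / \<delta> N powr \<beta>)
        ((chi N / \<delta> N powr (p + \<beta>)) powr (1 / (p + 1))) * ln (\<delta> N)) \<longlonglongrightarrow> 0"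
  shows "weak_conv_m
      (\<lambda>N. distr M borel (\<lambda>\<omega>. scale N * (beta_est N (\<delta> N) r (\<lambda>i. a i \<omega> + \<rho> N i \<omega>) - \<beta>)))
      (density lborel (normal_density 0 (\<beta> / sqrt \<kappa>)))"
proof -
  \<comment> \<open>The constant arises from the window mass in \<open>perturbation\<close>:
    \<open>2 * C * e * (2 * d) powr (\<beta> - 1)\<close> equals
    \<open>C * 2 powr \<beta> * e * d powr (\<beta> - 1)\<close>.\<close>
  have K: "0 \<le> C * 2 powr \<beta>" using tail.C by simp
  obtain e Q where eQ: "\<forall>\<^sub>F N in sequentially. 0 < e N \<and> e N \<le> \<delta> N \<and>
      C * 2 powr \<beta> * e N * \<delta> N powr (\<beta> - 1) + (chi N / e N powr p + chi' N) \<le> \<delta> N powr \<beta> * Q N"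
    and Q_lim: "(\<lambda>N. sqrt (real N * \<delta> N powr \<beta>) * \<bar>ln (\<delta> N)\<bar> * Q N) \<longlonglongrightarrow> 0"
    and Q_nonneg: "\<And>N. 0 \<le> Q N"
    using perturbation_scale_exists[OF \<delta>_pos \<delta>_lim N\<delta>_inf p chi K rate[unfolded scale_def]] by blast
  note Q0 = Q_lim[folded scale_def]
  define y where "y N i \<omega> = a i \<omega> + \<rho> N i \<omega>" for N i \<omega>
  have a_rv: "a i \<in> borel_measurable M" if "i \<in> {1..N}" for i N using a_measurable that by auto
  have y_rv: "y N i \<in> borel_measurable M" if "i \<in> {1..N}" for N i
    unfolding y_def using a_rv[OF that] \<rho>_rv[OF that] by (rule borel_measurable_add)
  define A' where "A' N \<omega> = (\<Sum>i=1..N. score \<beta> (\<delta> N) r (y N i \<omega>)) / scale N" for N \<omega>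
  define D' where "D' N \<omega> = (\<Sum>i=1..N. log_excess (\<delta> N) r (y N i \<omega>)) / (scale N)\<^sup>2" for N \<omega>
  define W where "W N \<omega> = scale N * (beta_est N (\<delta> N) r (\<lambda>i. y N i \<omega>) - \<beta>)" for N \<omega>
  have int_ex: "integrable M (\<lambda>\<omega>. exceed (\<delta> N) r (Y \<omega>))"
    and int_le: "integrable M (\<lambda>\<omega>. log_excess (\<delta> N) r (Y \<omega>))"
    and int_sc: "integrable M (\<lambda>\<omega>. score \<beta> (\<delta> N) r (Y \<omega>))"
    if [measurable]: "Y \<in> borel_measurable M" for N Y
  proof -
    show 1: "integrable M (\<lambda>\<omega>. exceed (\<delta> N) r (Y \<omega>))"
      by (rule integrable_const_bound[where B=1]) (use exceed_range in auto)
    show 2: "integrable M (\<lambda>\<omega>. log_excess (\<delta> N) r (Y \<omega>))"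
      by (rule integrable_const_bound[where B="(r - 1) * \<bar>ln (\<delta> N)\<bar>"])
        (use log_excess_bounded[OF \<delta>_pos[of N] tail.r] in auto)
    show "integrable M (\<lambda>\<omega>. score \<beta> (\<delta> N) r (Y \<omega>))" unfolding score_def using 1 2 by simp
  qed
  have [measurable]: "A' N \<in> borel_measurable M" for N
    unfolding A'_def[abs_def] using measurable_compose[OF y_rv score_measurable]
    by (intro borel_measurable_divide borel_measurable_sum) auto
  have [measurable]: "D' N \<in> borel_measurable M" for N
    unfolding D'_def[abs_def] using measurable_compose[OF y_rv log_excess_measurable]
    by (intro borel_measurable_divide borel_measurable_sum) auto
  have [measurable]: "W N \<in> borel_measurable M" for N
    unfolding W_def[abs_def] beta_est_eq
    using measurable_compose[OF y_rv log_excess_measurable] measurable_compose[OF y_rv exceed_measurable]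
    by (intro borel_measurable_times borel_measurable_diff borel_measurable_divide borel_measurable_sum borel_measurable_const) auto
  \<comment> \<open>Bringing the estimator minus \<beta> over the common denominator makes the
    numerator the sum of scores; the factor \<open>scale N\<close> is absorbed by dividing numerator
    and denominator by different powers of it.\<close>
  have W: "W N \<omega> = A' N \<omega> / D' N \<omega>" if "D' N \<omega> \<noteq> 0" for N \<omega>
  proof -
    have "scale N \<noteq> 0" "(\<Sum>i=1..N. log_excess (\<delta> N) r (y N i \<omega>)) \<noteq> 0"
      using that unfolding D'_def by auto
    then show ?thesis
      unfolding W_def A'_def D'_def beta_est_eq score_def
      by (simp add: sum_subtractf sum_distrib_left[symmetric] power2_eq_square field_simps)
  qed
  have small: "\<forall>\<^sub>F N in sequentially. 2 * \<delta> N < s0 \<and> ln (\<delta> N) \<le> - 1"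
  proof (rule eventually_\<delta>)
    have "\<forall>\<^sub>F d in at_right 0. ln d \<le> (-1::real)"
      using ln_at_0 by (simp add: filterlim_at_bot)
    moreover have "\<forall>\<^sub>F d in at_right 0. d < s0 / 2"
      unfolding eventually_at_right_field using tail.s0 by (intro exI[of _ "s0 / 2"]) auto
    ultimately show "\<forall>\<^sub>F d in at_right 0. 2 * d < s0 \<and> ln d \<le> -1"
      by eventually_elim auto
  qed
  have bounds: "\<forall>\<^sub>F N in sequentially.
      expectation (\<lambda>\<omega>. \<bar>A' N \<omega> - score_sum N \<omega>\<bar>) \<le> (1 + \<beta> * (r - 1)) * (scale N * \<bar>ln (\<delta> N)\<bar> * Q N) \<and>
      expectation (\<lambda>\<omega>. \<bar>D' N \<omega> - log_sum N \<omega>\<bar>) \<le> (r - 1) * (scale N * \<bar>ln (\<delta> N)\<bar> * Q N)"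
    using eQ small eventually_scale_ge_1
  proof eventually_elim
    case (elim N)
    let ?l = "\<bar>ln (\<delta> N)\<bar>" and ?B = "\<delta> N powr \<beta> * Q N"
    have d: "0 < \<delta> N" "\<delta> N < 1" "0 < e N" "e N \<le> \<delta> N" "2 * \<delta> N < s0"
      using elim tail.s0 \<delta>_pos[of N] by auto
    have l: "1 \<le> ?l" "ln (1 / \<delta> N) = ?l" using elim d by (auto simp: ln_div)
    have B: "0 \<le> ?B" using Q_nonneg[of N] by simp
    have bd: "expectation (\<lambda>\<omega>. \<bar>exceed (\<delta> N) r (y N i \<omega>) - exceed (\<delta> N) r (a i \<omega>)\<bar>) \<le> ?B \<and>
       expectation (\<lambda>\<omega>. \<bar>log_excess (\<delta> N) r (y N i \<omega>) - log_excess (\<delta> N) r (a i \<omega>)\<bar>) \<le> ?B * ((r - 1) * ?l)"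
      if i: "i \<in> {1..N}" for i
    proof -
      have "2 * C * e N * (2 * \<delta> N) powr (\<beta> - 1) = C * 2 powr \<beta> * e N * \<delta> N powr (\<beta> - 1)"
        using d by (simp add: powr_mult powr_diff)
      then have le: "2 * C * e N * (2 * \<delta> N) powr (\<beta> - 1) + (chi N / e N powr p + chi' N) \<le> ?B"
        using elim by (simp only:)
      have rt: "prob {\<omega> \<in> space M. \<bar>\<rho> N i \<omega>\<bar> > e N} \<le> chi N / e N powr p + chi' N"
        using \<rho>_tail[OF i] d by auto
      have di: "distr M borel (a i) = \<mu>" using distr_a i by auto
      note p = tail.perturbation[OF prob_space_axioms a_rv[OF i] \<rho>_rv[OF i] di d(1,5,3,4) rt, folded y_def]
      have "0 \<le> (r - 1) * ?l" using tail.r by simp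
      then show ?thesis
        using p order_trans[OF _ le] order_trans[OF _ mult_right_mono[OF le]] unfolding l(2) by blast
    qed
    have sc: "expectation (\<lambda>\<omega>. \<bar>score \<beta> (\<delta> N) r (y N i \<omega>) - score \<beta> (\<delta> N) r (a i \<omega>)\<bar>) \<le> ?B * (1 + \<beta> * ((r - 1) * ?l))"
      if i: "i \<in> {1..N}" for i
    proof -
      note ints = int_ex[OF y_rv[OF i], of N] int_ex[OF a_rv[OF i], of N] int_le[OF y_rv[OF i], of N] int_le[OF a_rv[OF i], of N]
        int_sc[OF y_rv[OF i], of N] int_sc[OF a_rv[OF i], of N]
      have "expectation (\<lambda>\<omega>. \<bar>score \<beta> (\<delta> N) r (y N i \<omega>) - score \<beta> (\<delta> N) r (a i \<omega>)\<bar>)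
        \<le> expectation (\<lambda>\<omega>. \<bar>exceed (\<delta> N) r (y N i \<omega>) - exceed (\<delta> N) r (a i \<omega>)\<bar>
          + \<beta> * \<bar>log_excess (\<delta> N) r (y N i \<omega>) - log_excess (\<delta> N) r (a i \<omega>)\<bar>)"
      proof (rule integral_mono)
        fix \<omega>
        let ?f = "exceed (\<delta> N) r (y N i \<omega>) - exceed (\<delta> N) r (a i \<omega>)"
        let ?g = "log_excess (\<delta> N) r (y N i \<omega>) - log_excess (\<delta> N) r (a i \<omega>)"
        have "score \<beta> (\<delta> N) r (y N i \<omega>) - score \<beta> (\<delta> N) r (a i \<omega>) = ?f - \<beta> * ?g"
          by (simp add: score_def algebra_simps)
        also have "\<bar>\<dots>\<bar> \<le> \<bar>?f\<bar> + \<bar>\<beta> * ?g\<bar>" by (rule abs_triangle_ineq4)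
        also have "\<bar>\<beta> * ?g\<bar> = \<beta> * \<bar>?g\<bar>" using tail.\<beta> by (simp add: abs_mult)
        finally show "\<bar>score \<beta> (\<delta> N) r (y N i \<omega>) - score \<beta> (\<delta> N) r (a i \<omega>)\<bar> \<le> \<bar>?f\<bar> + \<beta> * \<bar>?g\<bar>" .
      qed (use ints in auto)
      also have "\<dots> = expectation (\<lambda>\<omega>. \<bar>exceed (\<delta> N) r (y N i \<omega>) - exceed (\<delta> N) r (a i \<omega>)\<bar>)
          + \<beta> * expectation (\<lambda>\<omega>. \<bar>log_excess (\<delta> N) r (y N i \<omega>) - log_excess (\<delta> N) r (a i \<omega>)\<bar>)"
        using ints by simp
      also have "\<dots> \<le> ?B + \<beta> * (?B * ((r - 1) * ?l))"
        using bd[OF i] tail.\<beta> by (intro add_mono mult_left_mono) auto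
      finally show ?thesis by (simp add: algebra_simps)
    qed
    \<comment> \<open>Summing \<open>N\<close> equal bounds gives s^2 Q; one power of s survives in
      the numerator and none in the denominator.\<close>
    have NB: "real N * ?B = (scale N)\<^sup>2 * Q N" by (simp add: scale_square)
    have 1: "expectation (\<lambda>\<omega>. \<bar>A' N \<omega> - score_sum N \<omega>\<bar>) \<le> (1 + \<beta> * (r - 1)) * (scale N * ?l * Q N)"
    proof -
      have "expectation (\<lambda>\<omega>. \<bar>A' N \<omega> - score_sum N \<omega>\<bar>) \<le> real N * (?B * (1 + \<beta> * ((r - 1) * ?l))) / scale N"
        unfolding A'_def score_sum_def
        by (intro expectation_abs_sum_diff_le int_sc y_rv a_rv sc scale_nonneg)
      also have "\<dots> = (real N * ?B) * (1 + \<beta> * ((r - 1) * ?l)) / scale N" by simp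
      also have "\<dots> = scale N * Q N * (1 + \<beta> * ((r - 1) * ?l))"
        unfolding NB using elim by (simp add: power2_eq_square)
      \<comment> \<open>The indicator part carries no logarithm; as \<open>?l \<ge> 1\<close> it can
        be given one, so that a single null sequence controls everything.\<close>
      also have "\<dots> \<le> scale N * Q N * (?l + \<beta> * ((r - 1) * ?l))"
        using l scale_nonneg[of N] Q_nonneg[of N] by (intro mult_left_mono) auto
      finally show ?thesis by (simp add: algebra_simps)
    qed
    have 2: "expectation (\<lambda>\<omega>. \<bar>D' N \<omega> - log_sum N \<omega>\<bar>) \<le> (r - 1) * (scale N * ?l * Q N)"
    proof -
      have "expectation (\<lambda>\<omega>. \<bar>D' N \<omega> - log_sum N \<omega>\<bar>) \<le> real N * (?B * ((r - 1) * ?l)) / (scale N)\<^sup>2"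
        unfolding D'_def log_sum_def using bd
        by (intro expectation_abs_sum_diff_le int_le y_rv a_rv) auto
      also have "\<dots> = (real N * ?B) * ((r - 1) * ?l) / (scale N)\<^sup>2" by simp
      also have "\<dots> = 1 * (Q N * ((r - 1) * ?l))" unfolding NB using elim by simp
      \<comment> \<open>Deliberately wasteful: inserting \<open>scale N \<ge> 1\<close> reduces the
        denominator to the same null sequence as the numerator.\<close>
      also have "\<dots> \<le> scale N * (Q N * ((r - 1) * ?l))"
        using elim Q_nonneg[of N] tail.r by (intro mult_right_mono mult_nonneg_nonneg) auto
      finally show ?thesis by (simp add: algebra_simps)
    qed
    show ?case using 1 2 ..
  qed
  have lim_of_bound: "f \<longlonglongrightarrow> 0" if "\<And>N. 0 \<le> f N" "\<forall>\<^sub>F N in sequentially. f N \<le> c * (scale N * \<bar>ln (\<delta> N)\<bar> * Q N)" for f c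
    using that by (intro tendsto_sandwich[OF _ that(2) tendsto_const tendsto_mult_right_zero[OF Q0]]) auto
  define m where "m = \<kappa> / \<beta>"
  have m: "0 < m" using tail.\<kappa> tail.\<beta> by (simp add: m_def)
  have diff: "(\<lambda>N. prob {\<omega>\<in>space M. \<bar>W N \<omega> - score_sum N \<omega> / m\<bar> > \<epsilon>}) \<longlonglongrightarrow> 0" if "0 < \<epsilon>" for \<epsilon>
  proof (rule quotient_prob_tendsto[where A'=A' and D'=D' and D=log_sum and d=log_mean and K="2 * \<kappa> + 2"])
    show "integrable M (\<lambda>\<omega>. A' N \<omega> - score_sum N \<omega>)" for N
      unfolding A'_def score_sum_def by (intro Bochner_Integration.integrable_diff integrable_divide Bochner_Integration.integrable_sum int_sc y_rv a_rv)
    show "integrable M (\<lambda>\<omega>. D' N \<omega> - log_sum N \<omega>)" for N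
      unfolding D'_def log_sum_def by (intro Bochner_Integration.integrable_diff integrable_divide Bochner_Integration.integrable_sum int_le y_rv a_rv)
    show "(\<lambda>N. expectation (\<lambda>\<omega>. \<bar>A' N \<omega> - score_sum N \<omega>\<bar>)) \<longlonglongrightarrow> 0"
      by (rule lim_of_bound[OF _ eventually_mono[OF bounds]]) auto
    show "(\<lambda>N. expectation (\<lambda>\<omega>. \<bar>D' N \<omega> - log_sum N \<omega>\<bar>)) \<longlonglongrightarrow> 0"
      by (rule lim_of_bound[OF _ eventually_mono[OF bounds]]) auto
    show "log_mean \<longlonglongrightarrow> m" unfolding m_def by (rule log_mean_tendsto)
  qed (simp_all add: log_sum_centered_square score_sum_square m W that)
  have "weak_conv_m (\<lambda>N. distr M borel (W N)) (density lborel (normal_density 0 (\<beta> / sqrt \<kappa>)))"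
  proof (rule levy_continuity)
    have \<sigma>: "0 < \<beta> / sqrt \<kappa>" using tail.\<beta> tail.\<kappa> by simp
    show "real_distribution (distr M borel (W N))" for N
      by (rule real_distribution_distr) simp
    show "real_distribution (density lborel (normal_density 0 (\<beta> / sqrt \<kappa>)))"
      using prob_space_normal_density[OF \<sigma>] by (auto simp: real_distribution_def real_distribution_axioms_def)
    fix t
    have "(\<lambda>N. char (distr M borel (\<lambda>\<omega>. score_sum N \<omega> / m)) t) \<longlonglongrightarrow> complex_of_real (exp (- ((t / m)\<^sup>2 * \<kappa>) / 2))"
    proof -
      have "char (distr M borel (\<lambda>\<omega>. score_sum N \<omega> / m)) t = char (distr M borel (score_sum N)) (t / m)" for N
        unfolding char_def by (simp add: integral_distr)
      then show ?thesis using char_score_sum_tendsto[of "t / m"] by simp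
    qed
    \<comment> \<open>The variance \<kappa> of the limiting numerator, divided by m^2 with m =
      \<kappa>/\<beta>, is \<beta>^2/\<kappa>.\<close>
    moreover have "(t / m)\<^sup>2 * \<kappa> = t\<^sup>2 * (\<beta> / sqrt \<kappa>)\<^sup>2"
      using tail.\<kappa> tail.\<beta> by (simp add: m_def power2_eq_square field_simps)
    ultimately have lim: "(\<lambda>N. char (distr M borel (\<lambda>\<omega>. score_sum N \<omega> / m)) t) \<longlonglongrightarrow> char (density lborel (normal_density 0 (\<beta> / sqrt \<kappa>))) t"
      unfolding char_normal_density[OF \<sigma>] by simp
    show "(\<lambda>N. char (distr M borel (W N)) t) \<longlonglongrightarrow> char (density lborel (normal_density 0 (\<beta> / sqrt \<kappa>))) t"
      by (rule char_tendsto_of_prob_diff[OF _ _ lim diff]) simp_all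
  qed
  then show ?thesis by (simp add: W_def[abs_def] y_def)
qed

end

text \<open>\<open>normal_density\<close> is parametrised by the standard deviation, so
  \<open>\<beta> / sqrt \<kappa>\<close> stands for the variance \<beta>^2/\<kappa>. The common
  distribution function identifies all the laws with that of \<open>a 1\<close>, whose density near
  1 supplies the constants of the Pareto tail.\<close>

theorem theorem2:
  fixes M :: "'s measure"
    and a :: "nat \<Rightarrow> 's \<Rightarrow> real"
    and G g :: "real \<Rightarrow> real"
    and \<beta> \<nu> \<kappa> r p :: real
    and \<rho> :: "nat \<Rightarrow> nat \<Rightarrow> 's \<Rightarrow> real"
    and \<delta> chi chi' :: "nat \<Rightarrow> real"
  assumes M: "prob_space M"
    and a_rv: "\<And>i. i \<ge> 1 \<Longrightarrow> a i \<in> borel_measurable M"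
    and a_indep: "prob_space.indep_vars M (\<lambda>_. borel) a {1..}"
    and a_range: "\<And>i. i \<ge> 1 \<Longrightarrow> AE \<omega> in M. 0 < a i \<omega> \<and> a i \<omega> < 1"
    and a_cdf: "\<And>i. i \<ge> 1 \<Longrightarrow> cdf (distr M borel (a i)) = G"
    and G_C1: "\<exists>\<epsilon>. 0 < \<epsilon> \<and> \<epsilon> < 1 \<and>
                 (\<forall>x\<in>{1-\<epsilon><..<1}. (G has_real_derivative g x) (at x)) \<and>
                 continuous_on {1-\<epsilon><..<1} g"
    and g_asymp: "\<exists>h. h \<in> O[at_left 1](\<lambda>x. (1 - x) powr \<nu>) \<and>
                   (\<forall>\<^sub>F x in at_left 1. g x = \<kappa> * \<beta> * (1 - x) powr (\<beta> - 1) * (1 + h x))"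
    and \<beta>: "\<beta> > 1" and \<nu>: "\<nu> > 0" and \<kappa>: "\<kappa> > 0"
    and \<rho>_rv: "\<And>N i. i \<in> {1..N} \<Longrightarrow> \<rho> N i \<in> borel_measurable M"
    and r: "r > 1"
    and \<delta>_pos: "\<And>N. \<delta> N > 0"
    and \<delta>_lim: "\<delta> \<longlonglongrightarrow> 0"
    and N\<delta>_inf: "filterlim (\<lambda>N. real N * \<delta> N powr \<beta>) at_top sequentially"
    and N\<delta>_zero: "(\<lambda>N. real N * \<delta> N powr (\<beta> + 2 * min \<nu> ((r - 1) * \<beta>))) \<longlonglongrightarrow> 0"
    and p: "p \<ge> 1"
    and \<rho>_tail: "\<And>N i \<epsilon>. i \<in> {1..N} \<Longrightarrow> 0 < \<epsilon> \<Longrightarrow> \<epsilon> < 1 \<Longrightarrow>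
                   measure M {\<omega> \<in> space M. \<bar>\<rho> N i \<omega>\<bar> > \<epsilon>} \<le> chi N / \<epsilon> powr p + chi' N"
    and chi_nonneg: "\<And>N. chi N \<ge> 0"
    and chi_lim: "chi \<longlonglongrightarrow> 0"
    and chi'_lim: "chi' \<longlonglongrightarrow> 0"
    and rate: "(\<lambda>N. sqrt (real N * \<delta> N powr \<beta>) *
                 max (chi' N / \<delta> N powr \<beta>) ((chi N / \<delta> N powr (p + \<beta>)) powr (1 / (p + 1))) *
                 ln (\<delta> N)) \<longlonglongrightarrow> 0"
  shows "weak_conv_m
           (\<lambda>N. distr M borel (\<lambda>\<omega>. sqrt (real N * \<delta> N powr \<beta>) *
                (beta_est N (\<delta> N) r (\<lambda>i. a i \<omega> + \<rho> N i \<omega>) - \<beta>)))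
           (density lborel (normal_density 0 (\<beta> / sqrt \<kappa>)))"
proof -
  interpret prob_space M by fact
  define \<mu> where "\<mu> = distr M borel (a 1)"
  have rd: "real_distribution (distr M borel (a i))" if "i \<ge> 1" for i
    using a_rv[OF that] by (rule real_distribution_distr)
  have distr_a: "distr M borel (a i) = \<mu>" if "i \<ge> 1" for i
    unfolding \<mu>_def using a_cdf[OF that] a_cdf[of 1] that by (intro cdf_unique rd) auto
  interpret \<mu>: real_distribution \<mu> unfolding \<mu>_def by (rule rd) simp
  have cdf: "cdf \<mu> = G" unfolding \<mu>_def by (rule a_cdf) simp
  have below: "AE x in \<mu>. x < 1"
    unfolding \<mu>_def using a_range[of 1] a_rv[of 1] by (subst AE_distr_iff) (auto elim: AE_mp)
  have deriv: "\<forall>\<^sub>F x in at_left 1. (cdf \<mu> has_real_derivative g x) (at x)"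
  proof -
    obtain e where e: "0 < e" "\<forall>x\<in>{1-e<..<1}. (G has_real_derivative g x) (at x)"
      using G_C1 by blast
    show ?thesis unfolding cdf eventually_at_left_field
      using e by (intro exI[of _ "1 - e"]) auto
  qed
  obtain h where h: "h \<in> O[at_left 1](\<lambda>x. (1 - x) powr \<nu>)"
    "\<forall>\<^sub>F x in at_left 1. g x = \<kappa> * \<beta> * (1 - x) powr (\<beta> - 1) * (1 + h x)"
    using g_asymp by blast
  obtain C s0 where tail: "0 < C" "0 < s0" "s0 \<le> 1"
    "\<And>s. 0 < s \<Longrightarrow> s < s0 \<Longrightarrow> \<bar>\<mu>.prob {1 - s<..} - \<kappa> * s powr \<beta>\<bar> \<le> C * s powr (\<beta> + \<nu>)"
    "\<And>s u v. 0 < s \<Longrightarrow> s < s0 \<Longrightarrow> 1 - s \<le> u \<Longrightarrow> u \<le> v \<Longrightarrow> \<mu>.prob {u<..v} \<le> C * (v - u) * s powr (\<beta> - 1)"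
    using \<mu>.tail_of_regular_density[OF below deriv h \<beta> \<nu> \<kappa>] by metis
  interpret S: pareto_sample M \<mu> \<beta> \<nu> \<kappa> C s0 r a \<delta>
    by unfold_locales (fact \<beta> \<nu> \<kappa> r tail a_indep distr_a \<delta>_pos \<delta>_lim N\<delta>_inf N\<delta>_zero)+
  show ?thesis
    using S.beta_est_weak_conv[of \<rho> p chi chi', OF \<rho>_rv p \<rho>_tail chi_nonneg] rate
    unfolding S.scale_def by blast
qed

end
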